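(* Let $f: \mathbb{R}^n \to \mathbb{R}$ be a non-negative Morse--Bott function. Suppose that $f^{-1}(0)$ is a non-empty submanifold of $\mathbb{R}^n$. Given a gradient flow line $\gamma$ of $f$ with $\lim_{t\to\infty} \gamma(t) =: p \in f^{-1}(0)$, we have $$\limsup_{t \to \infty} \frac{|\mathcal{P}(\gamma(t) - p)|}{|\mathcal{Q}(\gamma(t) - p)|^2} < \infty,$$ where $\mathcal{P}$ is the orthogonal projection of $\mathbb{R}^n$ onto the tangent space $T_p f^{-1}(0)$ and $\mathcal{Q} = I - \mathcal{P}$.
   Context: A gradient flow line (GF) of $f$ is a curve $\gamma:(a,b)\to\mathbb{R}^n$, $-\infty\le a<b\le\infty$, with $\dot\gamma(t) = -\nabla f(\gamma(t))$ (here $b=\infty$). Let $N\subseteq \mathbb{R}^n$ be a critical submanifold of $f$ (a submanifold consisting of critical points). It is a non-degenerate critical manifold if for every $x\in N$ the restriction of the Hessian of $f$ at $x$ to the normal space of $N$ at $x$ is a non-degenerate bilinear form. A smooth function $f$ is Morse--Bott if its set of critical points is a disjoint union of non-degenerate critical manifolds. *)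

theory Defs
  imports "HOL-Analysis.Analysis"
begin

text \<open>\<open>Ck_on k f S\<close> is meant for open \<open>S\<close>: differentiability is taken at each point of the
  ambient space. The quantification over all directions \<open>v\<close> of \<open>x \<mapsto> Df(x) v\<close> amounts, in finite
  dimension, to the usual recursion on the total derivative.\<close>

primrec Ck_on ::
  "nat \<Rightarrow> ('a::real_normed_vector \<Rightarrow> 'b::real_normed_vector) \<Rightarrow> 'a set \<Rightarrow> bool" where
  "Ck_on 0 f S \<longleftrightarrow> continuous_on S f"
| "Ck_on (Suc k) f S \<longleftrightarrow>
     (\<forall>x\<in>S. f differentiable (at x)) \<and> (\<forall>v. Ck_on k (\<lambda>x. frechet_derivative f (at x) v) S)"

definition smooth_on ::
  "('a::real_normed_vector \<Rightarrow> 'b::real_normed_vector) \<Rightarrow> 'a set \<Rightarrow> bool" where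
  "smooth_on f S \<longleftrightarrow> (\<forall>k. Ck_on k f S)"

definition diffeomorphism_between ::
  "'a::euclidean_space set \<Rightarrow> 'a set \<Rightarrow> ('a \<Rightarrow> 'a) \<Rightarrow> ('a \<Rightarrow> 'a) \<Rightarrow> bool" where
  "diffeomorphism_between U V \<phi> \<psi> \<longleftrightarrow> homeomorphism U V \<phi> \<psi> \<and> smooth_on \<phi> U \<and> smooth_on \<psi> V"

text \<open>Smoothly embedded submanifolds without boundary, by slice charts. They are of pure dimension
  \<open>k\<close> and need be neither closed nor connected. The model slice is an arbitrary \<open>k\<close>-dimensional
  linear subspace instead of a fixed copy of \<open>\<real>\<^sup>k\<close>.\<close>

definition submanifold :: "nat \<Rightarrow> 'a::euclidean_space set \<Rightarrow> bool" where
  "submanifold k S \<longleftrightarrow>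
     (\<forall>x\<in>S. \<exists>U V W \<phi> \<psi>. open U \<and> x \<in> U \<and> open V \<and> subspace W \<and> dim W = k \<and>
        diffeomorphism_between U V \<phi> \<psi> \<and> \<phi> ` (S \<inter> U) = W \<inter> V)"

definition tangent_space :: "'a::euclidean_space set \<Rightarrow> 'a \<Rightarrow> 'a set" where
  "tangent_space S x =
     {v. \<exists>e>0. \<exists>c::real \<Rightarrow> 'a. smooth_on c {-e<..<e} \<and> c ` {-e<..<e} \<subseteq> S \<and> c 0 = x \<and>
           (c has_vector_derivative v) (at 0)}"

definition normal_space :: "'a::euclidean_space set \<Rightarrow> 'a \<Rightarrow> 'a set" where
  "normal_space S x = (tangent_space S x)\<^sup>\<bottom>"

definition gradient :: "('a::euclidean_space \<Rightarrow> real) \<Rightarrow> 'a \<Rightarrow> 'a" where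
  "gradient f x = (THE D. GDERIV f x :> D)"

lemma gradient_eq:
  fixes f :: "'a::euclidean_space \<Rightarrow> real"
  assumes "GDERIV f x :> D"
  shows "gradient f x = D"
  unfolding gradient_def
proof (rule the_equality)
  fix E assume "GDERIV f x :> E"
  with assms have "(\<lambda>h. inner h E) = (\<lambda>h. inner h D)"
    unfolding gderiv_def by (blast intro: has_derivative_unique)
  then show "E = D" unfolding fun_eq_iff vector_eq_ldot .
qed (fact assms)

lemma GDERIV_gradient:
  fixes f :: "'a::euclidean_space \<Rightarrow> real"
  assumes "f differentiable (at x)"
  shows "GDERIV f x :> gradient f x"
proof -
  obtain f' where f': "(f has_derivative f') (at x)"
    using assms unfolding differentiable_def by blast
  then have "linear f'" by (rule has_derivative_linear)
  then have "f' h = inner h (adjoint f' 1)" for h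
    using adjoint_works[of f' h "1::real"] by simp
  then have "f' = (\<lambda>h. inner h (adjoint f' 1))" by (rule ext)
  with f' have *: "GDERIV f x :> adjoint f' 1" unfolding gderiv_def by simp
  then show ?thesis unfolding gradient_eq[OF *] .
qed

definition critical_points :: "('a::euclidean_space \<Rightarrow> real) \<Rightarrow> 'a set" where
  "critical_points f = {x. GDERIV f x :> 0}"

definition hessian :: "('a::euclidean_space \<Rightarrow> real) \<Rightarrow> 'a \<Rightarrow> 'a \<Rightarrow> 'a \<Rightarrow> real" where
  "hessian f x u v = frechet_derivative (\<lambda>y. frechet_derivative f (at y) u) (at x) v"

definition nondegenerate_on :: "'a::euclidean_space set \<Rightarrow> ('a \<Rightarrow> 'a \<Rightarrow> real) \<Rightarrow> bool" where
  "nondegenerate_on W B \<longleftrightarrow> (\<forall>u\<in>W. (\<forall>v\<in>W. B u v = 0) \<longrightarrow> u = 0)"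

definition nondegenerate_critical_manifold ::
  "('a::euclidean_space \<Rightarrow> real) \<Rightarrow> 'a set \<Rightarrow> bool" where
  "nondegenerate_critical_manifold f N \<longleftrightarrow>
     (\<exists>k. submanifold k N) \<and> N \<subseteq> critical_points f \<and>
     (\<forall>x\<in>N. nondegenerate_on (normal_space N x) (hessian f x))"

text \<open>Different critical manifolds may have different dimensions. Nothing is lost by asking only for
  a set-theoretic disjoint union: non-degeneracy and the implicit function theorem make every member
  of the family relatively open in the critical set.\<close>

definition Morse_Bott :: "('a::euclidean_space \<Rightarrow> real) \<Rightarrow> bool" where
  "Morse_Bott f \<longleftrightarrow> smooth_on f UNIV \<and>
     (\<exists>\<N>. pairwise disjnt \<N> \<and> (\<forall>N\<in>\<N>. nondegenerate_critical_manifold f N) \<and>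
          \<Union>\<N> = critical_points f)"

definition gradient_flow_line ::
  "('a::euclidean_space \<Rightarrow> real) \<Rightarrow> ereal \<Rightarrow> ereal \<Rightarrow> (real \<Rightarrow> 'a) \<Rightarrow> bool" where
  "gradient_flow_line f a b \<gamma> \<longleftrightarrow> a < b \<and>
     (\<forall>t\<in>einterval a b. (\<gamma> has_vector_derivative - gradient f (\<gamma> t)) (at t))"

definition orthogonal_projection :: "'a::euclidean_space set \<Rightarrow> 'a \<Rightarrow> 'a" where
  "orthogonal_projection W x = (THE y. y \<in> W \<and> x - y \<in> W\<^sup>\<bottom>)"

lemma orthogonal_projection_eqI:
  assumes W: "subspace W" and y: "y \<in> W" "x - y \<in> W\<^sup>\<bottom>"
  shows "orthogonal_projection W x = y"
  unfolding orthogonal_projection_def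
proof (rule the_equality)
  fix z assume z: "z \<in> W \<and> x - z \<in> W\<^sup>\<bottom>"
  then have "z - y \<in> W" using W y by (simp add: subspace_diff)
  moreover have "z - y \<in> W\<^sup>\<bottom>"
    using subspace_diff[OF subspace_orthogonal_comp y(2), of "x - z"] z by simp
  ultimately show "z = y" by (auto simp: orthogonal_comp_def orthogonal_def)
qed (use y in simp)

lemma orthogonal_projection:
  assumes "subspace W"
  shows "orthogonal_projection W x \<in> W" "x - orthogonal_projection W x \<in> W\<^sup>\<bottom>"
proof -
  obtain y z where "y \<in> W" "\<And>w. w \<in> W \<Longrightarrow> orthogonal z w" "x = y + z"
    using orthogonal_subspace_decomp_exists[of W x] span_eq_iff[THEN iffD2, OF assms] by auto
  then have *: "y \<in> W" "x - y \<in> W\<^sup>\<bottom>" by (auto simp: orthogonal_comp_def orthogonal_commute)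
  then show "orthogonal_projection W x \<in> W" "x - orthogonal_projection W x \<in> W\<^sup>\<bottom>"
    unfolding orthogonal_projection_eqI[OF assms *] .
qed

end

theory Submission
  imports Defs
begin

text \<open>A flow line that converges to a zero \<open>p\<close> of \<open>f\<close> approaches it almost normally to the zero set
  \<open>S\<close>, because the gradient itself is almost normal to \<open>S\<close>.

  At \<open>p\<close> the Hessian \<open>H\<close> has kernel exactly \<open>T\<^sub>p S\<close>: tangent vectors are annihilated since the gradient
  vanishes on \<open>S\<close>, and non-degeneracy leaves nothing else (\<open>kernel_eq_tangent_space\<close>). Let \<open>x\<close> be near
  \<open>p\<close>, let \<open>s\<close> be the nearest point of \<open>S\<close> and \<open>h = x - s\<close>, which is almost normal. Then
  \<open>\<nabla>f(x) = H h + O(|x - p| |h|)\<close>. Since \<open>H\<close> is symmetric and injective on the normal space,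
  \<open>|\<nabla>f(x)|\<close> is comparable to \<open>|h|\<close>, \<open>f(x) = O(|\<nabla>f(x)|\<^sup>2)\<close>, and the tangential part of the gradient
  comes from the error term alone, so it is \<open>O(|x - p| |\<nabla>f(x)|)\<close> (\<open>gradient_estimates\<close>).

  The inequality \<open>f = O(|\<nabla>f|\<^sup>2)\<close> bounds the length of the flow line after time \<open>t\<close> by a multiple
  of \<open>\<surd>(f (\<gamma> t))\<close> (\<open>Lojasiewicz_length_bound\<close>). Hence \<open>|\<gamma> r - p| = O(\<surd>(f (\<gamma> t)))\<close> for \<open>r \<ge> t\<close>, and
  integrating the tangential velocity, which is smaller than the speed by the factor \<open>O(|\<gamma> r - p|)\<close>,
  gives \<open>|P(\<gamma> t - p)| = O(f (\<gamma> t)) = O(|\<gamma> t - p|\<^sup>2)\<close> (\<open>flow_decay\<close>). As \<open>\<gamma> t\<close> tends to \<open>p\<close>, this makes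
  the tangential part negligible against \<open>|\<gamma> t - p|\<close>, so that \<open>|\<gamma> t - p|\<close> may be replaced by
  \<open>2 |Q(\<gamma> t - p)|\<close> on the right (\<open>projection_eventually_quadratic\<close>).\<close>

section \<open>Smooth functions and curves\<close>

text \<open>On an open set the derivative at a point depends only on nearby values, so every level of
  \<^const>\<open>Ck_on\<close> respects equality on the set alone.\<close>

lemma Ck_on_cong:
  assumes "open S" "\<And>x. x \<in> S \<Longrightarrow> f x = g x" "Ck_on k f S"
  shows "Ck_on k g S"
  using assms(2,3)
proof (induction k arbitrary: f g)
  case 0
  then show ?case using continuous_on_cong[of S S f g] by simp
next
  case (Suc k)
  have "frechet_derivative f (at x) = frechet_derivative g (at x)" if "x \<in> S" for x
    using frechet_derivative_transform_within_open[of f x S g] Suc.prems that assms(1) by simp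
  then have "Ck_on k (\<lambda>x. frechet_derivative g (at x) v) S" for v
    using Suc.IH[of "\<lambda>x. frechet_derivative f (at x) v" "\<lambda>x. frechet_derivative g (at x) v"]
      Suc.prems(2) by simp
  moreover have "g differentiable (at x)" if "x \<in> S" for x
  proof -
    have "(f has_derivative frechet_derivative f (at x)) (at x)"
      using Suc.prems(2) that by (simp flip: frechet_derivative_works)
    then have "(g has_derivative frechet_derivative f (at x)) (at x)"
      by (rule has_derivative_transform_within_open[OF _ assms(1) that]) (rule Suc.prems(1))
    then show ?thesis by (rule differentiableI)
  qed
  ultimately show ?case by simp
qed

lemma has_vector_derivative_chain:
  assumes "(c has_vector_derivative v) (at t)" "(g has_derivative g') (at (c t))"
  shows "((\<lambda>s. g (c s)) has_vector_derivative g' v) (at t)"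
  using vector_derivative_diff_chain_within[of c v t UNIV g g'] assms
    has_derivative_at_withinI by (fastforce simp: o_def)

lemma has_vector_derivative_line:
  "((\<lambda>s. a + s *\<^sub>R w) has_vector_derivative w) (at t)"
  by (auto intro!: derivative_eq_intros)

text \<open>The curves that realise tangent vectors in a chart are images of straight lines. For a line the
  chain rule gives back the same kind of function, with \<open>g\<close> replaced by one of its directional
  derivatives, so smoothness follows by induction without a general composition theorem.\<close>

lemma Ck_on_compose_line:
  assumes "open V" "open I" "\<And>t. t \<in> I \<Longrightarrow> a + t *\<^sub>R w \<in> V" "Ck_on k g V"
  shows "Ck_on k (\<lambda>t::real. g (a + t *\<^sub>R w)) I"
  using assms(4)
proof (induction k arbitrary: g)
  case 0
  then show ?case using assms(3)
    by (auto intro!: continuous_on_compose2[of V g] continuous_intros)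
next
  case (Suc k)
  have d: "((\<lambda>t. g (a + t *\<^sub>R w)) has_derivative
      (\<lambda>v. frechet_derivative g (at (a + t *\<^sub>R w)) (v *\<^sub>R w))) (at t)" if "t \<in> I" for t
  proof -
    have "(g has_derivative frechet_derivative g (at (a + t *\<^sub>R w))) (at (a + t *\<^sub>R w))"
      using Suc.prems assms(3)[OF that] by (simp flip: frechet_derivative_works)
    then show ?thesis
      by (rule has_derivative_compose[rotated]) (auto intro!: derivative_eq_intros)
  qed
  have "Ck_on k (\<lambda>t. frechet_derivative (\<lambda>t. g (a + t *\<^sub>R w)) (at t) v) I" for v
  proof (rule Ck_on_cong[OF assms(2)])
    show "Ck_on k (\<lambda>t. frechet_derivative g (at (a + t *\<^sub>R w)) (v *\<^sub>R w)) I"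
      using Suc.IH[of "\<lambda>x. frechet_derivative g (at x) (v *\<^sub>R w)"] Suc.prems by simp
    show "frechet_derivative g (at (a + t *\<^sub>R w)) (v *\<^sub>R w) =
        frechet_derivative (\<lambda>t. g (a + t *\<^sub>R w)) (at t) v" if "t \<in> I" for t
      using frechet_derivative_at[OF d[OF that]] by metis
  qed
  moreover have "(\<lambda>t. g (a + t *\<^sub>R w)) differentiable (at t)" if "t \<in> I" for t
    using d[OF that] by (rule differentiableI)
  ultimately show ?case by simp
qed

lemma smooth_on_differentiable: "smooth_on f S \<Longrightarrow> x \<in> S \<Longrightarrow> f differentiable (at x)"
  unfolding smooth_on_def using Ck_on.simps(2)[of 0 f S] by blast

lemma smooth_on_frechet_derivative:
  "smooth_on f S \<Longrightarrow> smooth_on (\<lambda>x. frechet_derivative f (at x) v) S"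
  unfolding smooth_on_def using Ck_on.simps(2) by blast

lemma smooth_on_continuous: "smooth_on f S \<Longrightarrow> continuous_on S f"
  unfolding smooth_on_def using Ck_on.simps(1) by blast

section \<open>Tangent spaces in charts\<close>

lemma submanifold_chart:
  fixes S :: "'a::euclidean_space set"
  assumes "submanifold k S" "x \<in> S"
  obtains U V W :: "'a set" and \<phi> \<psi> where "open U" "x \<in> U" "open V" "subspace W"
    "homeomorphism U V \<phi> \<psi>" "smooth_on \<phi> U" "smooth_on \<psi> V" "\<phi> ` (S \<inter> U) = W \<inter> V"
  using assms unfolding submanifold_def diffeomorphism_between_def by meson

text \<open>Every normal vector of \<open>W\<close> annihilates the curve, hence also its velocity; and
  \<open>W\<^sup>\<bottom>\<^sup>\<bottom> = W\<close> in finite dimension.\<close>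

lemma derivative_in_subspace:
  fixes c :: "real \<Rightarrow> 'a::euclidean_space"
  assumes W: "subspace W" and d: "(c has_vector_derivative v) (at t)"
    and I: "open I" "t \<in> I" "\<And>s. s \<in> I \<Longrightarrow> c s \<in> W"
  shows "v \<in> W"
proof -
  have "orthogonal n v" if n: "n \<in> W\<^sup>\<bottom>" for n
  proof -
    have "((\<bullet>) n has_derivative (\<bullet>) n) (at (c t))"
      by (rule bounded_linear_imp_has_derivative[OF bounded_linear_inner_right])
    from has_vector_derivative_chain[OF d this]
    have "((\<lambda>s. n \<bullet> c s) has_vector_derivative n \<bullet> v) (at t)" .
    moreover have "n \<bullet> c s = 0" if "s \<in> I" for s
      using n I(3)[OF that] by (auto simp: orthogonal_comp_def orthogonal_def inner_commute)
    then have "((\<lambda>s. n \<bullet> c s) has_vector_derivative 0) (at t)"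
      using has_vector_derivative_transform_within_open
        [of "\<lambda>_. 0" 0 t I "\<lambda>s. n \<bullet> c s"] I(1,2) by simp
    ultimately show ?thesis
      unfolding orthogonal_def by (rule vector_derivative_unique_at)
  qed
  then have "v \<in> W\<^sup>\<bottom>\<^sup>\<bottom>" by (simp add: orthogonal_comp_def)
  then show ?thesis using orthogonal_comp_self[OF W] by simp
qed

text \<open>Pulling a straight line in the model subspace back to the submanifold gives a curve with
  prescribed velocity.\<close>

lemma chart_line:
  fixes S V :: "'a::euclidean_space set"
  assumes "open V" "subspace W" "homeomorphism U V \<phi> \<psi>" "smooth_on \<psi> V"
    "\<phi> ` (S \<inter> U) = W \<inter> V" and x: "x \<in> S \<inter> U" and w: "w \<in> W"
  obtains e where "e > 0"
    "\<And>t. t \<in> {-e<..<e} \<Longrightarrow> \<phi> x + t *\<^sub>R w \<in> V \<and> \<psi> (\<phi> x + t *\<^sub>R w) \<in> S"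
    "((\<lambda>t. \<psi> (\<phi> x + t *\<^sub>R w)) has_vector_derivative
        frechet_derivative \<psi> (at (\<phi> x)) w) (at 0)"
proof -
  have \<phi>x: "\<phi> x \<in> W \<inter> V" using assms(5) x by blast
  have "open ((\<lambda>t. \<phi> x + t *\<^sub>R w) -` V)"
    by (intro open_vimage continuous_intros assms(1))
  moreover have "0 \<in> (\<lambda>t. \<phi> x + t *\<^sub>R w) -` V" using \<phi>x by simp
  ultimately obtain e where e: "e > 0" "ball 0 e \<subseteq> (\<lambda>t. \<phi> x + t *\<^sub>R w) -` V"
    using open_contains_ball by blast
  have "\<phi> x + t *\<^sub>R w \<in> V \<and> \<psi> (\<phi> x + t *\<^sub>R w) \<in> S" if "t \<in> {-e<..<e}" for t
  proof -
    have "t \<in> ball 0 e" using that by (auto simp: dist_norm)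
    then have V: "\<phi> x + t *\<^sub>R w \<in> V" using e by blast
    moreover have "\<phi> x + t *\<^sub>R w \<in> W"
      using \<phi>x w assms(2) by (simp add: subspace_add subspace_mul)
    ultimately obtain y where "y \<in> S \<inter> U" "\<phi> x + t *\<^sub>R w = \<phi> y" using assms(5) by blast
    then show ?thesis using V assms(3) by (simp add: homeomorphism_def)
  qed
  moreover have "(\<psi> has_derivative frechet_derivative \<psi> (at (\<phi> x))) (at (\<phi> x + 0 *\<^sub>R w))"
    using smooth_on_differentiable[OF assms(4)] \<phi>x by (simp flip: frechet_derivative_works)
  note has_vector_derivative_chain[OF has_vector_derivative_line this]
  ultimately show thesis using that e(1) by blast
qed

text \<open>Velocities of curves form a subspace only because of a chart: a curve in \<open>S\<close> is mapped into
  the slice \<open>W\<close>, so its velocity is the image of a vector of \<open>W\<close>, and conversely each vector of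
  \<open>W\<close> is the velocity of a line.\<close>

lemma tangent_space_chart:
  fixes S V :: "'a::euclidean_space set"
  assumes U: "open U" "x \<in> U" and V: "open V" and W: "subspace W"
    and hom: "homeomorphism U V \<phi> \<psi>" and \<phi>: "smooth_on \<phi> U" and \<psi>: "smooth_on \<psi> V"
    and slice: "\<phi> ` (S \<inter> U) = W \<inter> V" and x: "x \<in> S"
  shows "tangent_space S x = frechet_derivative \<psi> (at (\<phi> x)) ` W"
proof
  have \<phi>x: "\<phi> x \<in> W \<inter> V" using slice x U(2) by blast
  have \<psi>\<phi>: "\<psi> (\<phi> y) = y" if "y \<in> U" for y using hom that by (simp add: homeomorphism_def)
  let ?D = "frechet_derivative \<psi> (at (\<phi> x))"
  have D: "(\<psi> has_derivative ?D) (at (\<phi> x))"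
    using smooth_on_differentiable[OF \<psi>] \<phi>x by (simp flip: frechet_derivative_works)
  show "tangent_space S x \<subseteq> ?D ` W"
  proof
    fix v assume "v \<in> tangent_space S x"
    then obtain e c where e: "e > 0" and sm: "smooth_on c {-e<..<e}"
      and cS: "c ` {-e<..<e} \<subseteq> S" and c0: "c 0 = x" and c': "(c has_vector_derivative v) (at 0)"
      unfolding tangent_space_def by blast
    define I where "I = {-e<..<e} \<inter> c -` U"
    have I: "open I" "0 \<in> I"
      using continuous_open_preimage[OF smooth_on_continuous[OF sm] _ U(1)] e c0 U(2)
      by (auto simp: I_def)
    have cI: "c t \<in> S \<inter> U" if "t \<in> I" for t using that cS by (auto simp: I_def)
    have "(\<phi> has_derivative frechet_derivative \<phi> (at x)) (at (c 0))"
      using smooth_on_differentiable[OF \<phi> U(2)] c0 by (simp flip: frechet_derivative_works)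
    from has_vector_derivative_chain[OF c' this]
    have \<phi>c: "((\<lambda>t. \<phi> (c t)) has_vector_derivative frechet_derivative \<phi> (at x) v) (at 0)" .
    have W1: "frechet_derivative \<phi> (at x) v \<in> W"
      by (rule derivative_in_subspace[OF W \<phi>c I]) (use cI slice in blast)
    have "((\<lambda>t. \<psi> (\<phi> (c t))) has_vector_derivative ?D (frechet_derivative \<phi> (at x) v)) (at 0)"
      by (rule has_vector_derivative_chain[OF \<phi>c]) (use D c0 in simp)
    then have "(c has_vector_derivative ?D (frechet_derivative \<phi> (at x) v)) (at 0)"
      by (rule has_vector_derivative_transform_within_open[OF _ I]) (use cI \<psi>\<phi> in blast)
    then have "v = ?D (frechet_derivative \<phi> (at x) v)"
      using c' vector_derivative_unique_at by blast
    then show "v \<in> ?D ` W" using W1 by blast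
  qed
  show "?D ` W \<subseteq> tangent_space S x"
  proof
    fix v assume "v \<in> ?D ` W"
    then obtain w where w: "w \<in> W" "v = ?D w" by blast
    obtain e where e: "e > 0" and
      eS: "\<And>t. t \<in> {-e<..<e} \<Longrightarrow> \<phi> x + t *\<^sub>R w \<in> V \<and> \<psi> (\<phi> x + t *\<^sub>R w) \<in> S" and
      e': "((\<lambda>t. \<psi> (\<phi> x + t *\<^sub>R w)) has_vector_derivative ?D w) (at 0)"
      using chart_line[OF V W hom \<psi> slice _ w(1), of x] x U(2) by blast
    have "smooth_on (\<lambda>t. \<psi> (\<phi> x + t *\<^sub>R w)) {-e<..<e}"
      using \<psi> eS unfolding smooth_on_def
      by (intro allI Ck_on_compose_line[OF V]) auto
    then show "v \<in> tangent_space S x"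
      unfolding tangent_space_def using e eS e' w(2) \<psi>\<phi>[OF U(2)]
      by (intro CollectI exI[of _ e] exI[of _ "\<lambda>t. \<psi> (\<phi> x + t *\<^sub>R w)"] conjI) auto
  qed
qed

lemma subspace_tangent_space:
  fixes S :: "'a::euclidean_space set"
  assumes "submanifold k S" "x \<in> S"
  shows "subspace (tangent_space S x)"
proof -
  obtain U V W :: "'a set" and \<phi> \<psi> where ch: "open U" "x \<in> U" "open V" "subspace W"
    "homeomorphism U V \<phi> \<psi>" "smooth_on \<phi> U" "smooth_on \<psi> V" "\<phi> ` (S \<inter> U) = W \<inter> V"
    by (rule submanifold_chart[OF assms])
  have "\<phi> x \<in> V" using ch(2,8) assms(2) by blast
  then have "linear (frechet_derivative \<psi> (at (\<phi> x)))"
    by (intro linear_frechet_derivative smooth_on_differentiable[OF ch(7)])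
  then show ?thesis
    using tangent_space_chart[OF ch assms(2)] ch(4) by (simp add: linear_subspace_image)
qed

section \<open>Second-order expansion at a point\<close>

lemma frechet_derivative_eq_inner_gradient:
  fixes f :: "'a::euclidean_space \<Rightarrow> real"
  assumes "f differentiable (at x)"
  shows "frechet_derivative f (at x) u = u \<bullet> gradient f x"
  using fun_cong[OF frechet_derivative_at[OF GDERIV_gradient[OF assms, unfolded gderiv_def]], of u]
  by simp

lemma differentiable_imp_eventually_Lipschitz_at:
  fixes g :: "'a::euclidean_space \<Rightarrow> 'b::real_normed_vector"
  assumes "g differentiable (at p)"
  obtains C where "C \<ge> 0" "\<forall>\<^sub>F x in nhds p. norm (g x - g p) \<le> C * norm (x - p)"
proof -
  obtain g' where g': "(g has_derivative g') (at p)"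
    using assms unfolding differentiable_def by blast
  then obtain d where d: "d > 0"
    "\<And>y. norm (y - p) < d \<Longrightarrow> norm (g y - g p - g' (y - p)) \<le> 1 * norm (y - p)"
    unfolding has_derivative_at_alt by (meson zero_less_one)
  obtain B where B: "B > 0" "\<And>v. norm (g' v) \<le> norm v * B"
    using bounded_linear.pos_bounded[OF has_derivative_bounded_linear[OF g']] by blast
  have "norm (g x - g p) \<le> (1 + B) * norm (x - p)" if "dist x p < d" for x
  proof -
    have "norm (g x - g p) \<le> norm (g x - g p - g' (x - p)) + norm (g' (x - p))"
      using norm_triangle_ineq[of "g x - g p - g' (x - p)" "g' (x - p)"] by simp
    also have "\<dots> \<le> 1 * norm (x - p) + norm (x - p) * B"
      using d(2)[of x] that B(2) by (intro add_mono) (auto simp: dist_norm)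
    finally show ?thesis by (simp add: algebra_simps)
  qed
  then have "\<forall>\<^sub>F x in nhds p. norm (g x - g p) \<le> (1 + B) * norm (x - p)"
    unfolding eventually_nhds_metric using d(1) by blast
  then show thesis using that[of "1 + B"] B(1) by simp
qed

text \<open>The Hessian is a derivative in its second argument, where linearity is automatic. In its first
  argument linearity is inherited from that of the first derivative.\<close>

lemma hessian_linear_left:
  fixes f :: "'a::euclidean_space \<Rightarrow> real"
  assumes sm: "smooth_on f UNIV"
  shows "hessian f x u v = (\<Sum>i\<in>Basis. (u \<bullet> i) * hessian f x i v)"
proof -
  let ?g = "\<lambda>u y. frechet_derivative f (at y) u"
  have g: "(?g u has_derivative hessian f x u) (at x)" for u
    unfolding hessian_def
    using smooth_on_differentiable[OF smooth_on_frechet_derivative[OF sm, of u], of x]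
    by (simp flip: frechet_derivative_works)
  have "?g u = (\<lambda>y. \<Sum>i\<in>Basis. (u \<bullet> i) * ?g i y)"
  proof
    fix y
    have d: "f differentiable (at y)" using smooth_on_differentiable[OF sm] by simp
    show "?g u y = (\<Sum>i\<in>Basis. (u \<bullet> i) * ?g i y)"
      unfolding frechet_derivative_eq_inner_gradient[OF d]
      by (subst euclidean_inner) (simp add: inner_commute)
  qed
  moreover have "((\<lambda>y. \<Sum>i\<in>Basis. (u \<bullet> i) * ?g i y) has_derivative
      (\<lambda>v. \<Sum>i\<in>Basis. (u \<bullet> i) * hessian f x i v)) (at x)"
    by (intro has_derivative_sum has_derivative_mult_right g)
  ultimately have "(?g u has_derivative (\<lambda>v. \<Sum>i\<in>Basis. (u \<bullet> i) * hessian f x i v)) (at x)"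
    by simp
  from has_derivative_unique[OF g this] show ?thesis by (rule fun_cong)
qed

text \<open>The gradient differs from its linearisation at \<open>p\<close> by a map whose Lipschitz constant on the ball
  of radius \<open>r\<close> is \<open>O(r)\<close>, because the Hessian, being differentiable at \<open>p\<close>, is
  \<open>O(r)\<close>-close to its value at \<open>p\<close>. The explicit rate \<open>O(r)\<close>, and not just \<open>o(1)\<close>, is what produces
  the exponent two in the final estimate.\<close>

lemma smooth_gradient_expansion:
  fixes f :: "'a::euclidean_space \<Rightarrow> real"
  assumes sm: "smooth_on f UNIV"
  obtains H C R where "linear H" "C \<ge> 0" "R > 0" "\<And>u v. u \<bullet> H v = hessian f p u v"
    "\<And>r x y. r \<le> R \<Longrightarrow> norm (x - p) \<le> r \<Longrightarrow> norm (y - p) \<le> r \<Longrightarrow>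
        norm (gradient f x - gradient f y - H (x - y)) \<le> C * r * norm (x - y)"
proof -
  define g where "g i y = frechet_derivative f (at y) i" for i y
  have diff: "f differentiable (at y)" for y using smooth_on_differentiable[OF sm] by simp
  have g_eq: "g i y = i \<bullet> gradient f y" for i y
    unfolding g_def by (rule frechet_derivative_eq_inner_gradient[OF diff])
  have g_smooth: "smooth_on (g i) UNIV" for i
    unfolding g_def by (rule smooth_on_frechet_derivative[OF sm])
  have g': "(g i has_derivative hessian f y i) (at y)" for i y
    unfolding hessian_def g_def[symmetric]
    using smooth_on_differentiable[OF g_smooth, of y] by (simp flip: frechet_derivative_works)
  have lin: "linear (hessian f y i)" for y i
    using has_derivative_linear[OF g'] .
  define H where "H v = (\<Sum>i\<in>Basis. hessian f p i v *\<^sub>R i)" for v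
  have H_hess: "u \<bullet> H v = hessian f p u v" for u v
    unfolding H_def hessian_linear_left[OF sm, of p u v]
    by (simp add: inner_sum_right mult.commute)
  have H_lin: "linear H"
  proof (rule linearI)
    show "H (x + y) = H x + H y" for x y
      by (simp add: H_def linear_add[OF lin] scaleR_add_left sum.distrib)
    show "H (c *\<^sub>R x) = c *\<^sub>R H x" for c x
      by (simp add: H_def linear_cmul[OF lin] scaleR_sum_right)
  qed
  have "\<exists>C. C \<ge> 0 \<and> (\<forall>\<^sub>F x in nhds p. \<bar>hessian f x i j - hessian f p i j\<bar> \<le> C * norm (x - p))"
    for i j
  proof -
    have "(\<lambda>x. hessian f x i j) differentiable (at p)"
      unfolding hessian_def g_def[symmetric]
      using smooth_on_differentiable[OF smooth_on_frechet_derivative[OF g_smooth[of i]], of p] by simp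
    then obtain C where "C \<ge> 0"
      "\<forall>\<^sub>F x in nhds p. norm (hessian f x i j - hessian f p i j) \<le> C * norm (x - p)"
      by (rule differentiable_imp_eventually_Lipschitz_at)
    then show ?thesis by (intro exI[of _ C] conjI) (simp_all only: real_norm_def)
  qed
  then have "\<forall>i. \<exists>C. \<forall>j. C j \<ge> 0 \<and>
      (\<forall>\<^sub>F x in nhds p. \<bar>hessian f x i j - hessian f p i j\<bar> \<le> C j * norm (x - p))"
    by (intro allI choice) simp
  from choice[OF this] obtain c where c: "\<And>i j. c i j \<ge> 0"
    "\<And>i j. \<forall>\<^sub>F x in nhds p. \<bar>hessian f x i j - hessian f p i j\<bar> \<le> c i j * norm (x - p)"
    by auto
  have "\<forall>\<^sub>F x in nhds p. \<forall>i\<in>Basis. \<forall>j\<in>Basis.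
      \<bar>hessian f x i j - hessian f p i j\<bar> \<le> c i j * norm (x - p)"
    by (intro eventually_ball_finite ballI c(2)) auto
  then obtain d where d: "d > 0" "\<And>x i j. dist x p < d \<Longrightarrow> i \<in> Basis \<Longrightarrow> j \<in> Basis \<Longrightarrow>
      \<bar>hessian f x i j - hessian f p i j\<bar> \<le> c i j * norm (x - p)"
    unfolding eventually_nhds_metric by auto
  define C where "C = (\<Sum>i\<in>Basis. \<Sum>j\<in>Basis. c i j)"
  have "norm (gradient f x - gradient f y - H (x - y)) \<le> C * r * norm (x - y)"
    if r: "r \<le> d / 2" and x: "norm (x - p) \<le> r" and y: "norm (y - p) \<le> r" for r x y
  proof -
    have r0: "r \<ge> 0" using x norm_ge_zero order_trans by blast
    have comp: "\<bar>g i x - g i y - hessian f p i (x - y)\<bar> \<le> (\<Sum>j\<in>Basis. c i j) * r * norm (x - y)"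
      if i: "i \<in> Basis" for i
    proof -
      let ?g' = "\<lambda>z v. hessian f z i v - hessian f p i v"
      have on: "onorm (?g' z) \<le> (\<Sum>j\<in>Basis. c i j) * r" if z: "z \<in> cball p r" for z
      proof (rule onorm_le)
        fix v :: 'a
        have "dist z p < d" using z r d(1) by (simp add: dist_commute)
        note dz = d(2)[OF this i]
        have lin': "linear (?g' z)" by (intro linear_compose_sub lin)
        have "?g' z v = ?g' z (\<Sum>j\<in>Basis. (v \<bullet> j) *\<^sub>R j)" by (simp only: euclidean_representation)
        also have "\<dots> = (\<Sum>j\<in>Basis. (v \<bullet> j) * ?g' z j)"
          by (simp only: linear_sum[OF lin'] linear_cmul[OF lin'] real_scaleR_def)
        also have "norm \<dots> \<le> (\<Sum>j\<in>Basis. norm v * (c i j * r))"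
        proof (rule sum_norm_le)
          fix j :: 'a assume j: "j \<in> Basis"
          have "\<bar>?g' z j\<bar> \<le> c i j * norm (z - p)" by (rule dz[OF j])
          also have "\<dots> \<le> c i j * r"
            using z c(1) by (intro mult_left_mono) (auto simp: dist_norm norm_minus_commute)
          finally show "norm ((v \<bullet> j) * ?g' z j) \<le> norm v * (c i j * r)"
            unfolding real_norm_def abs_mult by (intro mult_mono Basis_le_norm j) auto
        qed
        finally show "norm (?g' z v) \<le> (\<Sum>j\<in>Basis. c i j) * r * norm v"
          by (simp add: sum_distrib_right sum_distrib_left mult_ac)
      qed
      have "norm ((g i x - hessian f p i x) - (g i y - hessian f p i y))
          \<le> (\<Sum>j\<in>Basis. c i j) * r * norm (x - y)"
      proof (rule differentiable_bound[where S="cball p r" and f'="?g'"])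
        show "((\<lambda>x. g i x - hessian f p i x) has_derivative ?g' z) (at z within cball p r)" for z
          by (intro has_derivative_diff has_derivative_at_withinI[OF g']
              has_derivative_at_withinI[OF linear_imp_has_derivative[OF lin]])
      qed (use on x y in \<open>auto simp: dist_norm norm_minus_commute\<close>)
      then show ?thesis by (simp add: linear_diff[OF lin] algebra_simps)
    qed
    have "norm (gradient f x - gradient f y - H (x - y)) \<le>
        (\<Sum>i\<in>Basis. \<bar>(gradient f x - gradient f y - H (x - y)) \<bullet> i\<bar>)"
      by (rule norm_le_l1)
    also have "\<dots> = (\<Sum>i\<in>Basis. \<bar>g i x - g i y - hessian f p i (x - y)\<bar>)"
      unfolding g_eq H_hess[symmetric]
      by (rule sum.cong) (simp_all add: inner_diff_left inner_diff_right inner_commute)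
    also have "\<dots> \<le> (\<Sum>i\<in>Basis. (\<Sum>j\<in>Basis. c i j) * r * norm (x - y))"
      by (rule sum_mono) (rule comp)
    also have "\<dots> = C * r * norm (x - y)" unfolding C_def by (simp add: sum_distrib_right)
    finally show ?thesis .
  qed
  moreover have "C \<ge> 0" unfolding C_def by (intro sum_nonneg c(1))
  ultimately show thesis using that[of H C "d / 2"] H_lin H_hess d(1) by simp
qed

text \<open>The data that every estimate near \<open>p\<close> uses: \<open>H\<close> is the Hessian of \<open>f\<close> at \<open>p\<close> as a linear map, and
  \<open>C\<close>, \<open>R\<close> control the error of the linearised gradient.\<close>

locale gradient_expansion =
  fixes f :: "'a::euclidean_space \<Rightarrow> real" and p :: 'a and H :: "'a \<Rightarrow> 'a" and C R :: real
  assumes smooth: "smooth_on f UNIV"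
    and linear_H: "linear H"
    and C: "C \<ge> 0" and R: "R > 0"
    and H_hessian: "u \<bullet> H v = hessian f p u v"
    and expansion: "r \<le> R \<Longrightarrow> norm (x - p) \<le> r \<Longrightarrow> norm (y - p) \<le> r \<Longrightarrow>
        norm (gradient f x - gradient f y - H (x - y)) \<le> C * r * norm (x - y)"
begin

lemma f_differentiable: "f differentiable (at x)"
  using smooth_on_differentiable[OF smooth] by simp

lemma f_has_derivative: "(f has_derivative (\<lambda>h. h \<bullet> gradient f x)) (at x)"
  using GDERIV_gradient[OF f_differentiable] unfolding gderiv_def .

text \<open>The mixed second difference is the increment over \<open>0 \<le> s \<le> t\<close> of
  \<open>f (p + s u + t v) - f (p + s u)\<close>, whose derivative in \<open>s\<close> is a difference of gradients and hence
  close to \<open>t (u \<bullet> H v)\<close>.\<close>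

lemma second_difference:
  assumes t: "t > 0" "t * (norm u + norm v) \<le> R"
  shows "\<bar>f (p + t *\<^sub>R u + t *\<^sub>R v) - f (p + t *\<^sub>R u) - f (p + t *\<^sub>R v) + f p - t^2 * (u \<bullet> H v)\<bar>
      \<le> C * t^3 * (norm u + norm v) * norm u * norm v"
proof -
  let ?\<phi> = "\<lambda>s. f ((p + t *\<^sub>R v) + s *\<^sub>R u) - f (p + s *\<^sub>R u) - s * (t * (u \<bullet> H v))"
  let ?\<phi>' = "\<lambda>s. u \<bullet> gradient f ((p + t *\<^sub>R v) + s *\<^sub>R u) - u \<bullet> gradient f (p + s *\<^sub>R u)
      - t * (u \<bullet> H v)"
  let ?r = "t * (norm u + norm v)"
  let ?K = "norm u * (C * ?r * (t * norm v))"
  have \<phi>': "(?\<phi> has_vector_derivative ?\<phi>' s) (at s)" for s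
  proof -
    have along: "((\<lambda>s. f (a + s *\<^sub>R u)) has_vector_derivative u \<bullet> gradient f (a + s *\<^sub>R u)) (at s)" for a
      using has_vector_derivative_chain[OF has_vector_derivative_line f_has_derivative, of a u s] .
    have lin: "((\<lambda>s. s * (t * (u \<bullet> H v))) has_vector_derivative t * (u \<bullet> H v)) (at s)"
      using has_vector_derivative_mult_left[OF has_vector_derivative_id[of "at s"], of "t * (u \<bullet> H v)"] by simp
    show ?thesis by (rule has_vector_derivative_diff[OF has_vector_derivative_diff[OF along along] lin])
  qed
  have "norm (?\<phi> t - ?\<phi> 0) \<le> ?K * t - ?K * 0"
  proof (rule differentiable_bound_general[where \<phi>="\<lambda>s. ?K * s" and \<phi>'="\<lambda>_. ?K" and f="?\<phi>" and f'="?\<phi>'"])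
    show "continuous_on {0..t} ?\<phi>"
      using \<phi>' by (meson continuous_at_imp_continuous_on has_vector_derivative_continuous)
    fix s assume s: "0 < s" "s < t"
    let ?x = "(p + t *\<^sub>R v) + s *\<^sub>R u" and ?y = "p + s *\<^sub>R u"
    have "norm (s *\<^sub>R u) \<le> t * norm u" using s by (simp add: mult_right_mono)
    moreover have "norm (t *\<^sub>R v + s *\<^sub>R u) \<le> norm (t *\<^sub>R v) + norm (s *\<^sub>R u)"
      by (rule norm_triangle_ineq)
    moreover have "norm (t *\<^sub>R v) = t * norm v" "t * norm v \<ge> 0" using t(1) by simp_all
    ultimately have "norm (t *\<^sub>R v + s *\<^sub>R u) \<le> ?r" "norm (s *\<^sub>R u) \<le> ?r"
      unfolding distrib_left by linarith+
    moreover have "?x - p = t *\<^sub>R v + s *\<^sub>R u" "?y - p = s *\<^sub>R u" by simp_all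
    ultimately have "norm (?x - p) \<le> ?r" "norm (?y - p) \<le> ?r" by metis+
    then have "norm (gradient f ?x - gradient f ?y - H (?x - ?y)) \<le> C * ?r * norm (?x - ?y)"
      by (rule expansion[OF t(2)])
    then have *: "norm (gradient f ?x - gradient f ?y - t *\<^sub>R H v) \<le> C * ?r * (t * norm v)"
      using t(1) by (simp add: linear_cmul[OF linear_H])
    have "?\<phi>' s = u \<bullet> (gradient f ?x - gradient f ?y - t *\<^sub>R H v)"
      by (simp add: inner_diff_right)
    then have "norm (?\<phi>' s) \<le> norm u * norm (gradient f ?x - gradient f ?y - t *\<^sub>R H v)"
      using Cauchy_Schwarz_ineq2 by simp
    also have "\<dots> \<le> ?K" using * by (intro mult_left_mono) auto
    finally show "norm (?\<phi>' s) \<le> ?K" .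
    show "(?\<phi> has_vector_derivative ?\<phi>' s) (at s)" by (rule \<phi>')
    show "((\<lambda>s. ?K * s) has_vector_derivative ?K) (at s)"
      using has_vector_derivative_mult_right[OF has_vector_derivative_id[of "at s"], of ?K] by simp
  next
    show "continuous_on {0..t} (\<lambda>s. ?K * s)" by (intro continuous_intros)
  qed (rule t(1))
  then show ?thesis by (simp add: algebra_simps power2_eq_square power3_eq_cube)
qed

text \<open>The second difference is symmetric in \<open>u\<close> and \<open>v\<close> and approximates both \<open>t\<^sup>2 (u \<bullet> H v)\<close> and
  \<open>t\<^sup>2 (v \<bullet> H u)\<close> up to \<open>O(t\<^sup>3)\<close>.\<close>

lemma H_symmetric: "u \<bullet> H v = v \<bullet> H u"
proof (rule ccontr)
  let ?d = "\<bar>u \<bullet> H v - v \<bullet> H u\<bar>" and ?n = "norm u + norm v"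
  let ?K = "C * ?n * norm u * norm v"
  assume "u \<bullet> H v \<noteq> v \<bullet> H u"
  then have d: "?d > 0" by simp
  have K: "?K \<ge> 0" using C by simp
  \<comment> \<open>The first bound makes the expansion applicable at scale \<open>t\<close>; the second makes the error
    \<open>2 * ?K * t\<close> smaller than the supposed discrepancy.\<close>
  define t where "t = min (R / (?n + 1)) (?d / (2 * ?K + 1))"
  have t: "t > 0" unfolding t_def using d K R by (simp add: add_nonneg_pos)
  have "t * ?n \<le> R / (?n + 1) * ?n" unfolding t_def by (intro mult_right_mono) auto
  also have "\<dots> = R * (?n / (?n + 1))" by simp
  also have "\<dots> \<le> R * 1"
    using R by (intro mult_left_mono) (auto simp: divide_le_eq add_nonneg_pos)
  finally have tn: "t * ?n \<le> R" by simp
  have "\<bar>t^2 * (u \<bullet> H v) - t^2 * (v \<bullet> H u)\<bar> \<le> 2 * (t^3 * ?K)"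
    using second_difference[OF t tn] second_difference[of t v u] t tn
    by (simp add: algebra_simps abs_le_iff)
  moreover have "\<bar>t^2 * (u \<bullet> H v) - t^2 * (v \<bullet> H u)\<bar> = t^2 * ?d"
    by (simp add: abs_mult flip: right_diff_distrib)
  moreover have "2 * (t^3 * ?K) = t^2 * (2 * ?K * t)"
    by (simp add: power2_eq_square power3_eq_cube)
  ultimately have "t^2 * ?d \<le> t^2 * (2 * ?K * t)" by simp
  then have "?d \<le> 2 * ?K * t" using t by simp
  also have "\<dots> \<le> 2 * ?K * (?d / (2 * ?K + 1))"
    unfolding t_def using K by (intro mult_left_mono) auto
  also have "\<dots> < ?d" using d K by (simp add: field_simps add_nonneg_pos)
  finally show False by simp
qed

end

section \<open>The kernel of the Hessian at a zero\<close>

lemma gradient_eq_0_at_minimum: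
  fixes f :: "'a::euclidean_space \<Rightarrow> real"
  assumes "f differentiable (at x)" "\<And>y. f x \<le> f y"
  shows "gradient f x = 0"
proof -
  have "(f has_derivative (\<lambda>h. h \<bullet> gradient f x)) (at x)"
    using GDERIV_gradient[OF assms(1)] unfolding gderiv_def .
  then have "(\<lambda>h. h \<bullet> gradient f x) = (\<lambda>h. 0)"
    by (rule has_derivative_local_min) (simp add: assms(2))
  from fun_cong[OF this, of "gradient f x"] show ?thesis by simp
qed

context gradient_expansion
begin

lemma gradient_at_zero:
  assumes "\<And>x. 0 \<le> f x" "f x = 0"
  shows "gradient f x = 0"
  by (rule gradient_eq_0_at_minimum[OF f_differentiable]) (simp add: assms)

lemma critical_iff: "x \<in> critical_points f \<longleftrightarrow> gradient f x = 0"
  unfolding critical_points_def using GDERIV_gradient[OF f_differentiable, of x] gradient_eq by auto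

text \<open>The gradient vanishes along a curve of critical points; differentiate it in time.\<close>

lemma tangent_to_critical_set_in_kernel:
  assumes "N \<subseteq> critical_points f" "v \<in> tangent_space N p"
  shows "H v = 0"
proof -
  obtain e c where e: "e > 0" and cN: "c ` {-e<..<e} \<subseteq> N" and c0: "c 0 = p"
    and c': "(c has_vector_derivative v) (at 0)"
    using assms(2) unfolding tangent_space_def by blast
  have "u \<bullet> H v = 0" for u
  proof -
    let ?g = "\<lambda>y. frechet_derivative f (at y) u"
    have "(?g has_derivative hessian f p u) (at (c 0))"
      unfolding hessian_def c0
      using smooth_on_differentiable[OF smooth_on_frechet_derivative[OF smooth, of u], of p]
      by (simp flip: frechet_derivative_works)
    from has_vector_derivative_chain[OF c' this]
    have "((\<lambda>t. ?g (c t)) has_vector_derivative hessian f p u v) (at 0)" .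
    moreover have "?g (c t) = 0" if "t \<in> {-e<..<e}" for t
    proof -
      have "gradient f (c t) = 0" using cN assms(1) that critical_iff by blast
      then show ?thesis by (simp add: frechet_derivative_eq_inner_gradient[OF f_differentiable])
    qed
    then have "((\<lambda>t. ?g (c t)) has_vector_derivative 0) (at 0)"
      using has_vector_derivative_transform_within_open[of "\<lambda>_. 0" 0 0 "{-e<..<e}" "\<lambda>t. ?g (c t)"] e
      by simp
    ultimately show ?thesis unfolding H_hessian by (rule vector_derivative_unique_at)
  qed
  from this[of "H v"] show ?thesis by simp
qed

text \<open>A function is constant along a curve of critical points, so such a curve through a zero stays
  in the zero set.\<close>

lemma tangent_space_critical_subset_zeros:
  assumes N: "N \<subseteq> critical_points f" and p: "f p = 0"
  shows "tangent_space N p \<subseteq> tangent_space (f -` {0}) p"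
proof
  fix v assume "v \<in> tangent_space N p"
  then obtain e c where e: "e > 0" and sm: "smooth_on c {-e<..<e}"
    and cN: "c ` {-e<..<e} \<subseteq> N" and c0: "c 0 = p" and c': "(c has_vector_derivative v) (at 0)"
    unfolding tangent_space_def by blast
  have d: "((\<lambda>t. f (c t)) has_derivative (\<lambda>h. 0)) (at t within {-e<..<e})" if t: "t \<in> {-e<..<e}" for t
  proof -
    have "(c has_vector_derivative vector_derivative c (at t)) (at t)"
      using smooth_on_differentiable[OF sm t] vector_derivative_works by blast
    note * = has_vector_derivative_chain[OF this f_has_derivative]
    have "((\<lambda>t. f (c t)) has_vector_derivative 0) (at t)"
    proof -
      have "gradient f (c t) = 0" using cN N t critical_iff by blast
      then show ?thesis using * by simp
    qed
    then show ?thesis by (simp add: has_vector_derivative_def has_derivative_at_withinI)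
  qed
  have "f (c t) = 0" if t: "t \<in> {-e<..<e}" for t
    using has_derivative_zero_unique[OF _ d t, of 0] e c0 p by simp
  then show "v \<in> tangent_space (f -` {0}) p"
    unfolding tangent_space_def using e sm c0 c' by blast
qed

text \<open>Non-degeneracy speaks of the critical manifold \<open>N\<close> through \<open>p\<close> and not of the zero set. The
  tangent spaces satisfy \<open>T\<^sub>p N \<subseteq> T\<^sub>p f\<^sup>-\<^sup>1(0) \<subseteq> ker H\<close>. For \<open>v \<in> ker H\<close> the component of \<open>v\<close> normal to
  \<open>N\<close> lies in the kernel as well, so it is zero by non-degeneracy; hence all three spaces agree.\<close>

lemma kernel_eq_tangent_space:
  assumes nonneg: "\<And>x. 0 \<le> f x" and p: "f p = 0"
    and N: "nondegenerate_critical_manifold f N" "p \<in> N"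
  shows "tangent_space (f -` {0}) p = {v. H v = 0}"
proof
  have crit: "f -` {0} \<subseteq> critical_points f"
    using critical_iff gradient_at_zero[OF nonneg] by auto
  then show "tangent_space (f -` {0}) p \<subseteq> {v. H v = 0}"
    using tangent_to_critical_set_in_kernel by blast
  have Ncrit: "N \<subseteq> critical_points f" using N(1) unfolding nondegenerate_critical_manifold_def by blast
  have sub: "subspace (tangent_space N p)"
    using N subspace_tangent_space unfolding nondegenerate_critical_manifold_def by blast
  show "{v. H v = 0} \<subseteq> tangent_space (f -` {0}) p"
  proof
    fix v assume v: "v \<in> {v. H v = 0}"
    let ?a = "orthogonal_projection (tangent_space N p) v"
    have a: "?a \<in> tangent_space N p" and b: "v - ?a \<in> normal_space N p"
      using orthogonal_projection[OF sub] unfolding normal_space_def by auto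
    have "H (v - ?a) = 0"
      using v tangent_to_critical_set_in_kernel[OF Ncrit a] by (simp add: linear_diff[OF linear_H])
    then have "hessian f p (v - ?a) w = 0" for w
      using H_symmetric[of "v - ?a" w] by (simp flip: H_hessian)
    then have "v - ?a = 0"
      using N b unfolding nondegenerate_critical_manifold_def nondegenerate_on_def by blast
    then show "v \<in> tangent_space (f -` {0}) p"
      using a tangent_space_critical_subset_zeros[OF Ncrit p] by auto
  qed
qed

end

section \<open>Estimates near the zero set\<close>

text \<open>Test the bound with the projection itself. This reduces estimates of projections to estimates
  of scalar products with fixed vectors, to which calculus along curves applies directly.\<close>

lemma orthogonal_projection_norm_le:
  fixes W :: "'a::euclidean_space set"
  assumes W: "subspace W" and bound: "\<And>v. v \<in> W \<Longrightarrow> \<bar>v \<bullet> x\<bar> \<le> B * norm v" and "B \<ge> 0"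
  shows "norm (orthogonal_projection W x) \<le> B"
proof -
  let ?P = "orthogonal_projection W x"
  have "?P \<bullet> (x - ?P) = 0"
    using orthogonal_projection[OF W, of x] by (auto simp: orthogonal_comp_def orthogonal_def)
  then have "norm ?P * norm ?P = ?P \<bullet> x"
    by (simp add: inner_diff_right dot_square_norm power2_eq_square)
  also have "\<dots> \<le> B * norm ?P" using bound[OF orthogonal_projection(1)[OF W], of x] by simp
  finally show ?thesis using \<open>B \<ge> 0\<close> by (cases "?P = 0") simp_all
qed

text \<open>If \<open>s\<close> is a nearest point to \<open>x\<close>, then \<open>x - s\<close> is orthogonal to the tangent space at \<open>s\<close>, since the
  distance to \<open>x\<close> is minimal at \<open>s\<close> along every curve in \<open>S\<close>. The differential of the chart
  depends continuously on the base point, so the tangent spaces at \<open>s\<close> and \<open>p\<close> are close, and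
  \<open>x - s\<close> is almost orthogonal to the tangent space at \<open>p\<close>.\<close>

lemma nearest_point_displacement_nearly_normal:
  fixes S :: "'a::euclidean_space set"
  assumes S: "submanifold k S" and p: "p \<in> S" and \<epsilon>: "\<epsilon> > 0"
  obtains \<delta> where "\<delta> > 0"
    "\<And>s x v. s \<in> S \<Longrightarrow> norm (s - p) < \<delta> \<Longrightarrow> (\<And>y. y \<in> S \<Longrightarrow> norm (x - s) \<le> norm (x - y)) \<Longrightarrow>
        v \<in> tangent_space S p \<Longrightarrow> \<bar>(x - s) \<bullet> v\<bar> \<le> \<epsilon> * norm (x - s) * norm v"
proof -
  obtain U V W :: "'a set" and \<phi> \<psi> where ch: "open U" "p \<in> U" "open V" "subspace W"
    "homeomorphism U V \<phi> \<psi>" "smooth_on \<phi> U" "smooth_on \<psi> V" "\<phi> ` (S \<inter> U) = W \<inter> V"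
    by (rule submanifold_chart[OF S p])
  let ?D = "\<lambda>z. frechet_derivative \<psi> (at z)"
  have \<phi>V: "\<phi> x \<in> V" if "x \<in> U" for x using ch(5) that by (auto simp: homeomorphism_def)
  have lin: "linear (?D z)" if "z \<in> V" for z
    by (intro linear_frechet_derivative smooth_on_differentiable[OF ch(7) that])
  \<comment> \<open>A bounded linear choice of the vector of \<open>W\<close> that represents a given tangent vector at \<open>p\<close>.\<close>
  obtain g where g: "range g \<subseteq> W" "linear g" "\<And>v. v \<in> ?D (\<phi> p) ` W \<Longrightarrow> ?D (\<phi> p) (g v) = v"
    using linear_exists_right_inverse_on[OF lin[OF \<phi>V[OF ch(2)]] ch(4)] by auto
  obtain B where B: "B > 0" "\<And>v. norm (g v) \<le> B * norm v"
    using linear_bounded_pos[OF g(2)] by blast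
  \<comment> \<open>An upper bound for the operator norm of the change of the differential between \<open>p\<close> and \<open>x\<close>.\<close>
  let ?q = "\<lambda>x. \<Sum>j\<in>Basis. norm (?D (\<phi> p) j - ?D (\<phi> x) j)"
  have "continuous_on U (\<lambda>x. ?D (\<phi> x) j)" for j
    by (rule continuous_on_compose2[OF smooth_on_continuous[OF smooth_on_frechet_derivative[OF ch(7)]]
          smooth_on_continuous[OF ch(6)]]) (use \<phi>V in blast)
  then have "continuous_on U ?q" by (intro continuous_intros)
  then have "isCont ?q p" using ch(1,2) continuous_on_eq_continuous_at by blast
  then have "(?q \<longlongrightarrow> 0) (at p)" unfolding isCont_def by simp
  then have "\<forall>\<^sub>F x in at p. ?q x < \<epsilon> / B"
    using \<epsilon> B(1) by (intro order_tendstoD(2)[where y=0]) auto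
  then have "\<forall>\<^sub>F x in nhds p. ?q x < \<epsilon> / B"
    unfolding eventually_at_filter
  proof (rule eventually_mono)
    show "?q x < \<epsilon> / B" if "x \<noteq> p \<longrightarrow> x \<in> UNIV \<longrightarrow> ?q x < \<epsilon> / B" for x
      using that \<epsilon> B(1) by (cases "x = p") simp_all
  qed
  moreover have "\<forall>\<^sub>F x in nhds p. x \<in> U" by (rule eventually_nhds_in_open[OF ch(1,2)])
  ultimately have "\<forall>\<^sub>F x in nhds p. ?q x < \<epsilon> / B \<and> x \<in> U" by (rule eventually_conj)
  then obtain \<delta> where \<delta>: "\<delta> > 0" "\<And>x. dist x p < \<delta> \<Longrightarrow> ?q x < \<epsilon> / B \<and> x \<in> U"
    unfolding eventually_nhds_metric by blast
  have "\<bar>(x - s) \<bullet> v\<bar> \<le> \<epsilon> * norm (x - s) * norm v"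
    if s: "s \<in> S" "norm (s - p) < \<delta>" and near: "\<And>y. y \<in> S \<Longrightarrow> norm (x - s) \<le> norm (x - y)"
      and v: "v \<in> tangent_space S p" for s x v
  proof -
    have q: "?q s < \<epsilon> / B" and sU: "s \<in> U" using \<delta>(2)[of s] s(2) by (auto simp: dist_norm)
    let ?w = "g v"
    have w: "?w \<in> W" using g(1) by blast
    have v_eq: "?D (\<phi> p) ?w = v"
      using g(3) v tangent_space_chart[OF ch p] by simp
    have orth: "(x - s) \<bullet> ?D (\<phi> s) ?w = 0"
    proof -
      obtain e where e: "e > 0"
        "\<And>t. t \<in> {-e<..<e} \<Longrightarrow> \<phi> s + t *\<^sub>R ?w \<in> V \<and> \<psi> (\<phi> s + t *\<^sub>R ?w) \<in> S"
        and e': "((\<lambda>t. \<psi> (\<phi> s + t *\<^sub>R ?w)) has_vector_derivative ?D (\<phi> s) ?w) (at 0)"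
        using chart_line[OF ch(3,4,5,7,8) _ w, of s] s(1) sU by blast
      have s_eq: "\<psi> (\<phi> s) = s" using ch(5) sU by (simp add: homeomorphism_def)
      let ?c = "\<lambda>t. \<psi> (\<phi> s + t *\<^sub>R ?w)"
      have "((\<lambda>y. (x - y) \<bullet> (x - y)) has_derivative (\<lambda>h. - 2 * ((x - s) \<bullet> h))) (at (?c 0))"
        using s_eq by (auto intro!: derivative_eq_intros simp: inner_commute)
      from has_vector_derivative_chain[OF e' this]
      have "((\<lambda>t. (x - ?c t) \<bullet> (x - ?c t)) has_real_derivative - 2 * ((x - s) \<bullet> ?D (\<phi> s) ?w)) (at 0)"
        by (simp add: has_real_derivative_iff_has_vector_derivative)
      moreover have "\<forall>t. \<bar>0 - t\<bar> < e \<longrightarrow> (x - ?c 0) \<bullet> (x - ?c 0) \<le> (x - ?c t) \<bullet> (x - ?c t)"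
        using near e(2) s_eq by (simp add: norm_le abs_less_iff)
      ultimately have "- 2 * ((x - s) \<bullet> ?D (\<phi> s) ?w) = 0"
        using e(1) by (intro DERIV_local_min[of "\<lambda>t. (x - ?c t) \<bullet> (x - ?c t)"])
      then show ?thesis by simp
    qed
    have lin': "linear (\<lambda>u. ?D (\<phi> p) u - ?D (\<phi> s) u)"
      by (intro linear_compose_sub lin \<phi>V sU ch(2))
    have D_eq: "?D (\<phi> p) ?w - ?D (\<phi> s) ?w = (\<Sum>j\<in>Basis. (?w \<bullet> j) *\<^sub>R (?D (\<phi> p) j - ?D (\<phi> s) j))"
      by (subst (1 2) euclidean_representation[of ?w, symmetric])
        (simp only: linear_sum[OF lin'] linear_cmul[OF lin'])
    have "norm (?D (\<phi> p) ?w - ?D (\<phi> s) ?w) \<le> (\<Sum>j\<in>Basis. norm ?w * norm (?D (\<phi> p) j - ?D (\<phi> s) j))"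
      unfolding D_eq by (rule sum_norm_le) (simp add: mult_right_mono Basis_le_norm)
    also have "\<dots> = norm ?w * ?q s" by (simp add: sum_distrib_left)
    also have "\<dots> \<le> (B * norm v) * (\<epsilon> / B)"
      using q B by (intro mult_mono) (auto simp: sum_nonneg)
    also have "\<dots> = \<epsilon> * norm v" using B(1) by simp
    finally have D: "norm (?D (\<phi> p) ?w - ?D (\<phi> s) ?w) \<le> \<epsilon> * norm v" .
    have "\<bar>(x - s) \<bullet> v\<bar> = \<bar>(x - s) \<bullet> (?D (\<phi> p) ?w - ?D (\<phi> s) ?w)\<bar>"
      using orth v_eq by (simp add: inner_diff_right)
    also have "\<dots> \<le> norm (x - s) * norm (?D (\<phi> p) ?w - ?D (\<phi> s) ?w)"
      by (rule Cauchy_Schwarz_ineq2)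
    also have "\<dots> \<le> norm (x - s) * (\<epsilon> * norm v)" using D by (intro mult_left_mono) auto
    finally show ?thesis by (simp add: mult_ac)
  qed
  then show thesis using that \<delta>(1) by blast
qed

context gradient_expansion
begin

text \<open>Both \<open>f\<close> and its gradient vanish at \<open>s\<close> and the gradient is Lipschitz, so the mean value
  inequality on the segment from \<open>s\<close> to \<open>x\<close> gives a quadratic bound.\<close>

lemma quadratic_upper_bound:
  obtains L where "L > 0"
    "\<And>x s. norm (x - p) \<le> R \<Longrightarrow> norm (s - p) \<le> R \<Longrightarrow> f s = 0 \<Longrightarrow> gradient f s = 0 \<Longrightarrow>
        f x \<le> L * (norm (x - s))\<^sup>2"
proof -
  obtain M where M: "M > 0" "\<And>v. norm (H v) \<le> M * norm v"
    using linear_bounded_pos[OF linear_H] by blast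
  let ?L = "M + C * R"
  have "f x \<le> ?L * (norm (x - s))\<^sup>2"
    if x: "norm (x - p) \<le> R" and s: "norm (s - p) \<le> R" "f s = 0" "gradient f s = 0" for x s
  proof -
    have L0: "?L \<ge> 0" using M(1) C R by simp
    have grad: "norm (gradient f z) \<le> ?L * norm (x - s)" if z: "z \<in> closed_segment s x" for z
    proof -
      have "closed_segment s x \<subseteq> cball p R"
        using x s(1) by (intro closed_segment_subset) (auto simp: dist_norm norm_minus_commute)
      then have "norm (z - p) \<le> R" using z by (auto simp: dist_norm norm_minus_commute)
      from expansion[OF order_refl this s(1)]
      have "norm (gradient f z - H (z - s)) \<le> C * R * norm (z - s)" using s(3) by simp
      moreover have "norm (gradient f z) \<le> norm (gradient f z - H (z - s)) + norm (H (z - s))"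
        using norm_triangle_sub[of "gradient f z" "H (z - s)"] by simp
      moreover note M(2)[of "z - s"]
      ultimately have "norm (gradient f z) \<le> ?L * norm (z - s)" by (simp add: algebra_simps)
      also have "\<dots> \<le> ?L * norm (x - s)"
        using segment_bound(1)[OF z] L0 by (intro mult_left_mono) auto
      finally show ?thesis .
    qed
    have "norm (f x - f s) \<le> (?L * norm (x - s)) * norm (x - s)"
    proof (rule differentiable_bound[OF convex_closed_segment])
      show "(f has_derivative (\<lambda>h. h \<bullet> gradient f z)) (at z within closed_segment s x)" for z
        by (rule has_derivative_at_withinI[OF f_has_derivative])
      show "onorm (\<lambda>h. h \<bullet> gradient f z) \<le> ?L * norm (x - s)" if "z \<in> closed_segment s x" for z
      proof (rule onorm_le)
        fix h
        have "norm (h \<bullet> gradient f z) \<le> norm h * norm (gradient f z)"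
          by (simp add: Cauchy_Schwarz_ineq2)
        also have "\<dots> \<le> norm h * (?L * norm (x - s))" by (intro mult_left_mono grad that) simp
        finally show "norm (h \<bullet> gradient f z) \<le> (?L * norm (x - s)) * norm h" by (simp add: mult_ac)
      qed
    qed auto
    then show ?thesis using s(2) by (simp add: power2_eq_square mult_ac)
  qed
  moreover have "?L > 0" using M(1) C R by (simp add: add_pos_nonneg)
  ultimately show thesis using that by blast
qed

text \<open>Let \<open>s\<close> be the zero of \<open>f\<close> nearest to \<open>x\<close> and \<open>h = x - s\<close>, so that the gradient at \<open>x\<close> is \<open>H h\<close> up to
  an error \<open>O(|x - p| |h|)\<close>. Since \<open>h\<close> is almost normal to the tangent space and \<open>H\<close> is injective
  on the normal space, the gradient is bounded below by a multiple of \<open>|h|\<close>. Combined with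
  \<open>f x = O(|h|\<^sup>2)\<close> this is the first conclusion, the Lojasiewicz inequality with exponent one half.
  The image of the symmetric map \<open>H\<close> is orthogonal to its kernel, the tangent space, so only
  the error term contributes to the tangential part of the gradient, which is the second conclusion.\<close>

lemma gradient_estimates:
  assumes nonneg: "\<And>x. 0 \<le> f x" and p: "f p = 0" and S: "submanifold k (f -` {0})"
    and ker: "tangent_space (f -` {0}) p = {v. H v = 0}"
  obtains K \<rho> where "K > 0" "\<rho> > 0"
    "\<And>x. norm (x - p) < \<rho> \<Longrightarrow> f x \<le> K * (norm (gradient f x))\<^sup>2"
    "\<And>x v. norm (x - p) < \<rho> \<Longrightarrow> v \<in> tangent_space (f -` {0}) p \<Longrightarrow>
        \<bar>v \<bullet> gradient f x\<bar> \<le> K * norm (x - p) * norm (gradient f x) * norm v"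
    "\<And>x. norm (x - p) < \<rho> \<Longrightarrow> f x \<le> K * (norm (x - p))\<^sup>2"
proof -
  let ?S = "f -` {0}" and ?T = "tangent_space (f -` {0}) p"
  have pS: "p \<in> ?S" using p by simp
  have T: "subspace ?T" by (rule subspace_tangent_space[OF S pS])
  have Tn: "subspace (?T\<^sup>\<bottom>)" by (rule subspace_orthogonal_comp)
  have "H v = 0 \<longrightarrow> v = 0" if "v \<in> ?T\<^sup>\<bottom>" for v
    using that ker by (auto simp: orthogonal_comp_def orthogonal_def)
  then obtain \<mu> where \<mu>: "\<mu> > 0" "\<And>v. v \<in> ?T\<^sup>\<bottom> \<Longrightarrow> norm (H v) \<ge> \<mu> * norm v"
    using injective_imp_isometric[OF closed_subspace[OF Tn] Tn
        linear_conv_bounded_linear[THEN iffD1, OF linear_H]] by blast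
  obtain \<delta> where \<delta>: "\<delta> > 0" "\<And>s x v. s \<in> ?S \<Longrightarrow> norm (s - p) < \<delta> \<Longrightarrow>
      (\<And>y. y \<in> ?S \<Longrightarrow> norm (x - s) \<le> norm (x - y)) \<Longrightarrow> v \<in> ?T \<Longrightarrow>
      \<bar>(x - s) \<bullet> v\<bar> \<le> 1/2 * norm (x - s) * norm v"
    using nearest_point_displacement_nearly_normal[OF S pS, of "1/2"] by auto
  obtain L where L: "L > 0"
    "\<And>x s. norm (x - p) \<le> R \<Longrightarrow> norm (s - p) \<le> R \<Longrightarrow> f s = 0 \<Longrightarrow> gradient f s = 0 \<Longrightarrow>
        f x \<le> L * (norm (x - s))\<^sup>2"
    by (rule quadratic_upper_bound) blast
  have "continuous_on UNIV f" by (rule smooth_on_continuous[OF smooth])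
  then have closed: "closed ?S" by (intro closed_vimage) auto
  \<comment> \<open>The bounds keep the nearest zero, which lies within \<open>2 * \<rho>\<close> of \<open>p\<close>, in the range of the
    expansion and of \<open>\<delta>\<close>, and make the error at most half of the lower bound \<open>\<mu> / 2\<close> for \<open>H\<close>.\<close>
  define \<rho> where "\<rho> = min (min (R / 2) (\<delta> / 2)) (\<mu> / 8 / (C + 1))"
  have \<rho>: "\<rho> > 0" "2 * \<rho> \<le> R" "2 * \<rho> \<le> \<delta>" unfolding \<rho>_def using R \<delta>(1) \<mu>(1) C by auto
  have "C * (2 * \<rho>) \<le> (C + 1) * (2 * (\<mu> / 8 / (C + 1)))"
    unfolding \<rho>_def using C \<mu>(1) R \<delta>(1) by (intro mult_mono) auto
  also have "\<dots> = \<mu> / 4"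
  proof -
    have "8 * C + 8 \<noteq> 0" using C by simp
    then show ?thesis by (simp add: field_simps)
  qed
  finally have \<rho>4: "C * (2 * \<rho>) \<le> \<mu> / 4" .
  have key: "\<exists>h. norm h \<le> 4 / \<mu> * norm (gradient f x) \<and> f x \<le> L * (norm h)\<^sup>2 \<and>
      norm (gradient f x - H h) \<le> C * (2 * norm (x - p)) * norm h"
    if x: "norm (x - p) < \<rho>" for x
  proof -
    obtain s where s: "s \<in> ?S" "\<And>y. y \<in> ?S \<Longrightarrow> dist x s \<le> dist x y"
      using distance_attains_inf[OF closed, of x] pS by blast
    have near: "norm (x - s) \<le> norm (x - y)" if "y \<in> ?S" for y
      using s(2)[OF that] by (simp add: dist_norm)
    have sp: "norm (s - p) \<le> 2 * norm (x - p)"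
      using near[OF pS] norm_triangle_ineq4[of "x - p" "x - s"] by simp
    have gs: "gradient f s = 0" using gradient_at_zero[OF nonneg] s(1) by simp
    let ?h = "x - s" and ?P = "orthogonal_projection ?T (x - s)"
    have P: "?P \<in> ?T" "?h - ?P \<in> ?T\<^sup>\<bottom>" using orthogonal_projection[OF T] by auto
    have "norm ?P \<le> 1/2 * norm ?h"
    proof (rule orthogonal_projection_norm_le[OF T])
      show "\<bar>v \<bullet> ?h\<bar> \<le> 1/2 * norm ?h * norm v" if "v \<in> ?T" for v
        using \<delta>(2)[OF s(1) _ near that] sp x \<rho>(3) by (simp add: inner_commute)
    qed simp
    then have "norm ?h / 2 \<le> norm (?h - ?P)" using norm_triangle_sub[of ?h ?P] by simp
    then have "\<mu> * (norm ?h / 2) \<le> \<mu> * norm (?h - ?P)" using \<mu>(1) by simp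
    also have "\<dots> \<le> norm (H (?h - ?P))" by (rule \<mu>(2)[OF P(2)])
    also have "\<dots> = norm (H ?h)" using P(1) ker by (simp add: linear_diff[OF linear_H])
    finally have Hh: "\<mu> / 2 * norm ?h \<le> norm (H ?h)" by simp
    have g: "norm (gradient f x - H ?h) \<le> C * (2 * norm (x - p)) * norm ?h"
      using expansion[of "2 * norm (x - p)" x s] sp x \<rho>(2) gs by simp
    also have "\<dots> \<le> C * (2 * \<rho>) * norm ?h"
      using x C by (intro mult_right_mono mult_left_mono) auto
    also have "\<dots> \<le> \<mu> / 4 * norm ?h" by (intro mult_right_mono \<rho>4) simp
    finally have "norm (H ?h) \<le> norm (gradient f x) + \<mu> / 4 * norm ?h"
      using norm_triangle_sub[of "H ?h" "gradient f x"] by (simp add: norm_minus_commute)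
    with Hh have "\<mu> * norm ?h \<le> 4 * norm (gradient f x)" by simp
    then have "norm ?h \<le> 4 / \<mu> * norm (gradient f x)" using \<mu>(1) by (simp add: field_simps)
    moreover have "f x \<le> L * (norm ?h)\<^sup>2"
      using L(2)[of x s] x \<rho> sp s(1) gs by simp
    ultimately show ?thesis using g by blast
  qed
  define K where "K = L * (4 / \<mu>)\<^sup>2 + C * 2 * (4 / \<mu>) + L"
  have pos: "L * (4 / \<mu>)\<^sup>2 \<ge> 0" "C * 2 * (4 / \<mu>) \<ge> 0" using L(1) C \<mu>(1) by simp_all
  show thesis
  proof (rule that)
    show "K > 0" unfolding K_def using pos L(1) by linarith
    show "\<rho> > 0" by (rule \<rho>(1))
    fix x assume x: "norm (x - p) < \<rho>"
    obtain h where h: "norm h \<le> 4 / \<mu> * norm (gradient f x)" "f x \<le> L * (norm h)\<^sup>2"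
      "norm (gradient f x - H h) \<le> C * (2 * norm (x - p)) * norm h"
      using key[OF x] by blast
    have "f x \<le> L * (4 / \<mu> * norm (gradient f x))\<^sup>2"
      using h(2) power_mono[OF h(1), of 2] L(1) by (meson less_imp_le mult_left_mono norm_ge_zero order_trans)
    also have "\<dots> = L * (4 / \<mu>)\<^sup>2 * (norm (gradient f x))\<^sup>2" by (simp add: power_mult_distrib power_divide)
    also have "\<dots> \<le> K * (norm (gradient f x))\<^sup>2"
      unfolding K_def using pos L(1) by (intro mult_right_mono) auto
    finally show "f x \<le> K * (norm (gradient f x))\<^sup>2" .
    have "f x \<le> L * (norm (x - p))\<^sup>2"
      using L(2)[of x p] x \<rho> R p gradient_at_zero[OF nonneg p] by simp
    also have "\<dots> \<le> K * (norm (x - p))\<^sup>2"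
      unfolding K_def using pos by (intro mult_right_mono) auto
    finally show "f x \<le> K * (norm (x - p))\<^sup>2" .
    fix v assume v: "v \<in> ?T"
    then have "v \<bullet> H h = 0" using H_symmetric[of v h] ker by simp
    then have "\<bar>v \<bullet> gradient f x\<bar> = \<bar>v \<bullet> (gradient f x - H h)\<bar>" by (simp add: inner_diff_right)
    also have "\<dots> \<le> norm v * norm (gradient f x - H h)" by (rule Cauchy_Schwarz_ineq2)
    also have "\<dots> \<le> norm v * (C * (2 * norm (x - p)) * (4 / \<mu> * norm (gradient f x)))"
      using h(3) mult_left_mono[OF h(1), of "C * (2 * norm (x - p))"] C
      by (intro mult_left_mono) auto
    also have "\<dots> = (C * 2 * (4 / \<mu>)) * (norm (x - p) * norm (gradient f x) * norm v)" by simp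
    also have "\<dots> \<le> K * (norm (x - p) * norm (gradient f x) * norm v)"
      unfolding K_def using pos L(1) by (intro mult_right_mono) auto
    finally show "\<bar>v \<bullet> gradient f x\<bar> \<le> K * norm (x - p) * norm (gradient f x) * norm v"
      by (simp add: mult_ac)
  qed
qed

end

section \<open>Decay along the gradient flow\<close>

lemma descent_along_flow:
  fixes \<gamma> :: "real \<Rightarrow> 'a::euclidean_space"
  assumes diff: "\<And>x. f differentiable (at x)"
    and flow: "(\<gamma> has_vector_derivative - gradient f (\<gamma> t)) (at t)"
  shows "((\<lambda>t. f (\<gamma> t)) has_real_derivative - (norm (gradient f (\<gamma> t)))\<^sup>2) (at t)"
proof -
  have "(f has_derivative (\<lambda>h. h \<bullet> gradient f (\<gamma> t))) (at (\<gamma> t))"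
    using GDERIV_gradient[OF diff] unfolding gderiv_def .
  from has_vector_derivative_chain[OF flow this] show ?thesis
    by (simp add: has_real_derivative_iff_has_vector_derivative dot_square_norm)
qed

lemma decreasing_along_flow:
  fixes \<gamma> :: "real \<Rightarrow> 'a::euclidean_space"
  assumes diff: "\<And>x. f differentiable (at x)"
    and flow: "\<And>t. t \<ge> t0 \<Longrightarrow> (\<gamma> has_vector_derivative - gradient f (\<gamma> t)) (at t)"
    and "t0 \<le> t" "t \<le> r"
  shows "f (\<gamma> r) \<le> f (\<gamma> t)"
proof (rule DERIV_nonpos_imp_nonincreasing[OF \<open>t \<le> r\<close>], intro exI conjI)
  show "((\<lambda>r. f (\<gamma> r)) has_real_derivative - (norm (gradient f (\<gamma> s)))\<^sup>2) (at s)"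
    if "t \<le> s" for s
    using descent_along_flow[OF diff flow, of s] that \<open>t0 \<le> t\<close> by simp
qed simp

text \<open>Along the flow \<open>(d/dr) \<surd>f = - |\<nabla>f|\<^sup>2 / (2 \<surd>f)\<close>, and the Lojasiewicz inequality turns this into
  \<open>|\<nabla>f| \<le> - 2 \<surd>K (d/dr) \<surd>f\<close>. So any curve \<open>\<beta>\<close> whose speed is at most \<open>M\<close> times that of the flow line
  has length at most \<open>2 M \<surd>K\<close> times the drop of \<open>\<surd>f\<close>. It is used for the flow line itself and for its
  scalar products with tangent vectors.\<close>

lemma Lojasiewicz_length_bound:
  fixes \<gamma> :: "real \<Rightarrow> 'a::euclidean_space" and \<beta> :: "real \<Rightarrow> 'b::real_normed_vector"
  assumes diff: "\<And>x. f differentiable (at x)"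
    and flow: "\<And>r. r \<in> {t..T} \<Longrightarrow> (\<gamma> has_vector_derivative - gradient f (\<gamma> r)) (at r)"
    and \<beta>: "\<And>r. r \<in> {t..T} \<Longrightarrow> (\<beta> has_vector_derivative \<beta>' r) (at r)"
    and speed: "\<And>r. r \<in> {t..T} \<Longrightarrow> norm (\<beta>' r) \<le> M * norm (gradient f (\<gamma> r))"
    and pos: "\<And>r. r \<in> {t..T} \<Longrightarrow> f (\<gamma> r) > 0"
    and Lojasiewicz: "\<And>r. r \<in> {t..T} \<Longrightarrow> f (\<gamma> r) \<le> K * (norm (gradient f (\<gamma> r)))\<^sup>2"
    and "t < T" "M \<ge> 0" "K > 0"
  shows "norm (\<beta> T - \<beta> t) \<le> M * (2 * sqrt K) * sqrt (f (\<gamma> t))"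
proof -
  let ?c = "M * (2 * sqrt K)"
  let ?g = "\<lambda>r. norm (gradient f (\<gamma> r))"
  let ?\<phi> = "\<lambda>r. - ?c * sqrt (f (\<gamma> r))"
  let ?\<phi>' = "\<lambda>r. - ?c * (- (?g r)\<^sup>2 * (inverse (sqrt (f (\<gamma> r))) / 2))"
  have \<phi>': "(?\<phi> has_vector_derivative ?\<phi>' r) (at r)" if r: "r \<in> {t..T}" for r
  proof -
    have "((\<lambda>r. sqrt (f (\<gamma> r))) has_real_derivative
        inverse (sqrt (f (\<gamma> r))) / 2 * - (?g r)\<^sup>2) (at r)"
      by (rule DERIV_chain2[OF DERIV_real_sqrt[OF pos[OF r]] descent_along_flow[OF diff flow[OF r]]])
    from DERIV_cmult[OF this, of "- ?c"] show ?thesis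
      by (simp add: has_real_derivative_iff_has_vector_derivative mult_ac)
  qed
  have "norm (\<beta> T - \<beta> t) \<le> ?\<phi> T - ?\<phi> t"
  proof (rule differentiable_bound_general[where f'=\<beta>' and \<phi>'="?\<phi>'"])
    show "t < T" by fact
    show "continuous_on {t..T} \<beta>"
      by (rule continuous_at_imp_continuous_on) (blast intro: has_vector_derivative_continuous \<beta>)
    show "continuous_on {t..T} ?\<phi>"
      by (rule continuous_at_imp_continuous_on) (blast intro: has_vector_derivative_continuous \<phi>')
    fix r assume "t < r" "r < T"
    then have r: "r \<in> {t..T}" by simp
    show "(\<beta> has_vector_derivative \<beta>' r) (at r)" "(?\<phi> has_vector_derivative ?\<phi>' r) (at r)"
      using \<beta>[OF r] \<phi>'[OF r] by simp_all
    let ?s = "sqrt (f (\<gamma> r))"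
    have s: "?s > 0" using pos[OF r] by simp
    have "?s \<le> sqrt K * ?g r"
      using real_sqrt_le_mono[OF Lojasiewicz[OF r]] by (simp add: real_sqrt_mult)
    then have "?s * ?g r \<le> sqrt K * ?g r * ?g r" by (intro mult_right_mono) auto
    then have "?g r \<le> sqrt K * (?g r)\<^sup>2 * inverse ?s"
      using s by (simp add: field_simps power2_eq_square)
    then have "M * ?g r \<le> M * (sqrt K * (?g r)\<^sup>2 * inverse ?s)"
      using \<open>M \<ge> 0\<close> by (rule mult_left_mono)
    also have "\<dots> = ?\<phi>' r" by simp
    finally show "norm (\<beta>' r) \<le> ?\<phi>' r" using speed[OF r] by linarith
  qed
  also have "\<dots> \<le> ?c * sqrt (f (\<gamma> t))"
    using pos[of T] \<open>t < T\<close> \<open>M \<ge> 0\<close> \<open>K > 0\<close> by simp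
  finally show ?thesis .
qed

text \<open>This disposes of the points where \<open>\<surd>f\<close> fails to be differentiable along the flow.\<close>

lemma flow_reaching_minimum_is_constant:
  fixes \<gamma> :: "real \<Rightarrow> 'a::euclidean_space"
  assumes diff: "\<And>x. f differentiable (at x)" and nonneg: "\<And>x. 0 \<le> f x"
    and flow: "\<And>t. t \<ge> t0 \<Longrightarrow> (\<gamma> has_vector_derivative - gradient f (\<gamma> t)) (at t)"
    and zero: "f (\<gamma> t0) = 0" and t: "t \<ge> t0"
  shows "\<gamma> t = \<gamma> t0"
proof -
  have "f (\<gamma> r) = 0" if "r \<ge> t0" for r
  proof -
    have "f (\<gamma> r) \<le> f (\<gamma> t0)"
      by (rule decreasing_along_flow[OF diff flow order_refl that])
    then show ?thesis using zero nonneg[of "\<gamma> r"] by simp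
  qed
  then have "gradient f (\<gamma> r) = 0" if "r \<ge> t0" for r
    using gradient_eq_0_at_minimum[OF diff, of "\<gamma> r"] nonneg that by simp
  then have "(\<gamma> has_derivative (\<lambda>h. 0)) (at r within {t0..})" if "r \<in> {t0..}" for r
    using flow[of r] that by (simp add: has_vector_derivative_def has_derivative_at_withinI)
  then show ?thesis
    using has_derivative_zero_unique[of "{t0..}" \<gamma> t t0] t by simp
qed

text \<open>The length bound for the flow line on \<open>[r, \<infinity>)\<close> gives the first conclusion. In particular
  \<open>|\<gamma> r - p| \<le> 2 \<surd>K \<surd>(f (\<gamma> t))\<close> for all \<open>r \<ge> t\<close>, so after time \<open>t\<close> the tangential speed is at most a
  multiple of \<open>\<surd>(f (\<gamma> t)) |\<nabla>f|\<close>. A second use of the length bound then yields another factor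
  \<open>\<surd>(f (\<gamma> t))\<close>.\<close>

lemma flow_decay:
  fixes \<gamma> :: "real \<Rightarrow> 'a::euclidean_space"
  assumes diff: "\<And>x. f differentiable (at x)" and nonneg: "\<And>x. 0 \<le> f x"
    and flow: "\<And>t. t \<ge> t0 \<Longrightarrow> (\<gamma> has_vector_derivative - gradient f (\<gamma> t)) (at t)"
    and lim: "(\<gamma> \<longlongrightarrow> p) at_top" and near: "\<And>t. t \<ge> t0 \<Longrightarrow> norm (\<gamma> t - p) < \<rho>"
    and T: "subspace T" and K: "K > 0"
    and Lojasiewicz: "\<And>x. norm (x - p) < \<rho> \<Longrightarrow> f x \<le> K * (norm (gradient f x))\<^sup>2"
    and tangential: "\<And>x v. norm (x - p) < \<rho> \<Longrightarrow> v \<in> T \<Longrightarrow>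
        \<bar>v \<bullet> gradient f x\<bar> \<le> K * norm (x - p) * norm (gradient f x) * norm v"
    and pos: "\<And>t. t \<ge> t0 \<Longrightarrow> f (\<gamma> t) > 0"
    and t: "t \<ge> t0"
  shows "norm (\<gamma> t - p) \<le> 2 * sqrt K * sqrt (f (\<gamma> t))"
    and "norm (orthogonal_projection T (\<gamma> t - p)) \<le> 4 * K\<^sup>2 * f (\<gamma> t)"
proof -
  have dist: "norm (\<gamma> r - p) \<le> 2 * sqrt K * sqrt (f (\<gamma> r))" if r: "r \<ge> t0" for r
  proof -
    have "norm (\<gamma> s - \<gamma> r) \<le> 1 * (2 * sqrt K) * sqrt (f (\<gamma> r))" if "s > r" for s
      by (rule Lojasiewicz_length_bound[OF diff, where \<beta>'="\<lambda>r. - gradient f (\<gamma> r)" and T=s])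
        (use that r K flow pos Lojasiewicz near in auto)
    then have "\<forall>\<^sub>F s in at_top. norm (\<gamma> s - \<gamma> r) \<le> 2 * sqrt K * sqrt (f (\<gamma> r))"
      by (intro eventually_mono[OF eventually_gt_at_top[of r]]) simp
    moreover have "((\<lambda>s. norm (\<gamma> s - \<gamma> r)) \<longlongrightarrow> norm (p - \<gamma> r)) at_top"
      by (intro tendsto_intros lim)
    ultimately have "norm (p - \<gamma> r) \<le> 2 * sqrt K * sqrt (f (\<gamma> r))"
      by (intro tendsto_upperbound[of _ _ at_top]) auto
    then show ?thesis by (simp add: norm_minus_commute)
  qed
  then show "norm (\<gamma> t - p) \<le> 2 * sqrt K * sqrt (f (\<gamma> t))" using t by blast
  have decr: "f (\<gamma> r) \<le> f (\<gamma> t)" if "r \<ge> t" for r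
    by (rule decreasing_along_flow[OF diff flow t that])
  let ?M = "2 * sqrt K * sqrt (f (\<gamma> t))"
  have M: "?M \<ge> 0" using K nonneg by simp
  show "norm (orthogonal_projection T (\<gamma> t - p)) \<le> 4 * K\<^sup>2 * f (\<gamma> t)"
  proof (rule orthogonal_projection_norm_le[OF T])
    show "4 * K\<^sup>2 * f (\<gamma> t) \<ge> 0" using nonneg by simp
    fix v assume v: "v \<in> T"
    have "\<bar>v \<bullet> \<gamma> s - v \<bullet> \<gamma> t\<bar> \<le> 4 * K\<^sup>2 * f (\<gamma> t) * norm v" if s: "s > t" for s
    proof -
      have "norm (v \<bullet> \<gamma> s - v \<bullet> \<gamma> t) \<le> (K * ?M * norm v) * (2 * sqrt K) * sqrt (f (\<gamma> t))"
      proof (rule Lojasiewicz_length_bound[OF diff, where \<beta>'="\<lambda>r. v \<bullet> - gradient f (\<gamma> r)" and T=s])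
        show "K * ?M * norm v \<ge> 0" using K M by simp
        fix r assume r: "r \<in> {t..s}"
        then have r0: "r \<ge> t0" using t by simp
        show "((\<lambda>r. v \<bullet> \<gamma> r) has_vector_derivative v \<bullet> - gradient f (\<gamma> r)) (at r)"
          by (rule has_vector_derivative_chain[OF flow[OF r0]
                bounded_linear_imp_has_derivative[OF bounded_linear_inner_right]])
        have "norm (\<gamma> r - p) \<le> 2 * sqrt K * sqrt (f (\<gamma> r))" by (rule dist[OF r0])
        also have "\<dots> \<le> ?M" using decr[of r] r K by (intro mult_left_mono) auto
        finally have rM: "norm (\<gamma> r - p) \<le> ?M" .
        have "norm (v \<bullet> - gradient f (\<gamma> r)) \<le> K * norm (\<gamma> r - p) * norm (gradient f (\<gamma> r)) * norm v"
          using tangential[OF near[OF r0] v] by simp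
        also have "\<dots> \<le> K * ?M * norm (gradient f (\<gamma> r)) * norm v"
          using K rM by (intro mult_right_mono mult_left_mono) auto
        finally show "norm (v \<bullet> - gradient f (\<gamma> r)) \<le> K * ?M * norm v * norm (gradient f (\<gamma> r))"
          by (simp add: mult_ac)
      qed (use t s K flow pos Lojasiewicz near in auto)
      also have "\<dots> = 4 * K * (sqrt K)\<^sup>2 * (sqrt (f (\<gamma> t)))\<^sup>2 * norm v"
        by (simp only: power2_eq_square mult_ac)
      also have "\<dots> = 4 * K\<^sup>2 * f (\<gamma> t) * norm v"
        using K nonneg[of "\<gamma> t"] by (simp add: power2_eq_square)
      finally show ?thesis by simp
    qed
    then have "\<forall>\<^sub>F s in at_top. \<bar>v \<bullet> \<gamma> s - v \<bullet> \<gamma> t\<bar> \<le> 4 * K\<^sup>2 * f (\<gamma> t) * norm v"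
      by (intro eventually_mono[OF eventually_gt_at_top[of t]]) blast
    moreover have "((\<lambda>s. \<bar>v \<bullet> \<gamma> s - v \<bullet> \<gamma> t\<bar>) \<longlongrightarrow> \<bar>v \<bullet> p - v \<bullet> \<gamma> t\<bar>) at_top"
      by (intro tendsto_intros lim)
    ultimately have "\<bar>v \<bullet> p - v \<bullet> \<gamma> t\<bar> \<le> 4 * K\<^sup>2 * f (\<gamma> t) * norm v"
      by (intro tendsto_upperbound[of _ _ at_top]) auto
    then show "\<bar>v \<bullet> (\<gamma> t - p)\<bar> \<le> 4 * K\<^sup>2 * f (\<gamma> t) * norm v"
      by (simp add: inner_diff_right abs_minus_commute)
  qed
qed

text \<open>From \<open>|P x| = O(f) = O(|x|\<^sup>2)\<close> with \<open>x = \<gamma> t - p\<close> the tangential part is eventually at most half of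
  \<open>|x|\<close>, so \<open>|x|\<close> is at most twice the normal part and may be replaced by it.\<close>

lemma projection_eventually_quadratic:
  fixes \<gamma> :: "real \<Rightarrow> 'a::euclidean_space"
  assumes diff: "\<And>x. f differentiable (at x)" and nonneg: "\<And>x. 0 \<le> f x"
    and flow: "\<And>t. t \<ge> t0 \<Longrightarrow> (\<gamma> has_vector_derivative - gradient f (\<gamma> t)) (at t)"
    and lim: "(\<gamma> \<longlongrightarrow> p) at_top"
    and T: "subspace T" and K: "K > 0" and \<rho>: "\<rho> > 0"
    and Lojasiewicz: "\<And>x. norm (x - p) < \<rho> \<Longrightarrow> f x \<le> K * (norm (gradient f x))\<^sup>2"
    and tangential: "\<And>x v. norm (x - p) < \<rho> \<Longrightarrow> v \<in> T \<Longrightarrow>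
        \<bar>v \<bullet> gradient f x\<bar> \<le> K * norm (x - p) * norm (gradient f x) * norm v"
    and upper: "\<And>x. norm (x - p) < \<rho> \<Longrightarrow> f x \<le> K * (norm (x - p))\<^sup>2"
  obtains B where "\<forall>\<^sub>F t in at_top. norm (orthogonal_projection T (\<gamma> t - p)) \<le>
      B * (norm (\<gamma> t - p - orthogonal_projection T (\<gamma> t - p)))\<^sup>2"
proof -
  let ?P = "\<lambda>t. orthogonal_projection T (\<gamma> t - p)"
  define B where "B = 4 * K\<^sup>2 * K"
  have B: "B > 0" unfolding B_def using K by simp
  have "\<forall>\<^sub>F t in at_top. norm (?P t) \<le> 4 * B * (norm (\<gamma> t - p - ?P t))\<^sup>2"
  proof (cases "\<exists>s\<ge>t0. f (\<gamma> s) = 0")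
    case True
    then obtain s where s: "s \<ge> t0" "f (\<gamma> s) = 0" by blast
    have const: "\<gamma> t = \<gamma> s" if "t \<ge> s" for t
      using flow_reaching_minimum_is_constant[OF diff nonneg flow s(2) that] s(1) by simp
    then have "(\<gamma> \<longlongrightarrow> \<gamma> s) at_top"
      by (intro tendsto_eventually eventually_mono[OF eventually_ge_at_top[of s]])
    then have "\<gamma> s = p" using lim by (intro tendsto_unique[of at_top]) auto
    moreover have "orthogonal_projection T 0 = 0"
      by (rule orthogonal_projection_eqI[OF T])
        (auto simp: subspace_0[OF T] subspace_0[OF subspace_orthogonal_comp])
    ultimately have "?P t = 0" if "t \<ge> s" for t using const[OF that] by simp
    then show ?thesis
      using B by (intro eventually_mono[OF eventually_ge_at_top[of s]]) simp
  next
    case False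
    \<comment> \<open>The second bound makes \<open>B |x|\<^sup>2 \<le> |x| / 2\<close> when \<open>|x| < \<epsilon>\<close>.\<close>
    define \<epsilon> where "\<epsilon> = min \<rho> (1 / (2 * B))"
    have \<epsilon>: "\<epsilon> > 0" "\<epsilon> \<le> \<rho>" "B * \<epsilon> \<le> 1 / 2"
      unfolding \<epsilon>_def using \<rho> B mult_left_mono[OF min.cobounded2, of B \<rho> "1 / (2 * B)"] by auto
    have "\<forall>\<^sub>F t in at_top. dist (\<gamma> t) p < \<epsilon>" using lim \<epsilon>(1) by (rule tendstoD)
    then obtain s where "\<And>t. t \<ge> s \<Longrightarrow> norm (\<gamma> t - p) < \<epsilon>"
      unfolding eventually_at_top_linorder dist_norm by blast
    then obtain s where s: "s \<ge> t0" "\<And>t. t \<ge> s \<Longrightarrow> norm (\<gamma> t - p) < \<epsilon>"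
      by (meson max.bounded_iff max.cobounded1)
    have pos: "f (\<gamma> t) > 0" if "t \<ge> s" for t
      using False nonneg[of "\<gamma> t"] that s(1) by (metis order.trans order_le_less)
    have "norm (?P t) \<le> 4 * B * (norm (\<gamma> t - p - ?P t))\<^sup>2" if t: "t \<ge> s" for t
    proof -
      let ?x = "\<gamma> t - p"
      have near: "norm (\<gamma> t - p) < \<rho>" if "t \<ge> s" for t using s(2)[OF that] \<epsilon>(2) by simp
      have "norm (?P t) \<le> 4 * K\<^sup>2 * f (\<gamma> t)"
        by (rule flow_decay(2)[OF diff nonneg _ lim near T K Lojasiewicz tangential pos t])
          (use flow s(1) in auto)
      also have "\<dots> \<le> 4 * K\<^sup>2 * (K * (norm ?x)\<^sup>2)"
        by (intro mult_left_mono upper near[OF t]) simp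
      finally have P: "norm (?P t) \<le> B * (norm ?x)\<^sup>2" unfolding B_def by (simp add: mult_ac)
      also have "\<dots> = (B * norm ?x) * norm ?x" by (simp add: power2_eq_square)
      also have "\<dots> \<le> (B * \<epsilon>) * norm ?x"
        using s(2)[OF t] B by (intro mult_right_mono mult_left_mono) auto
      also have "\<dots> \<le> 1 / 2 * norm ?x" by (intro mult_right_mono \<epsilon>(3)) simp
      finally have "norm ?x \<le> 2 * norm (?x - ?P t)"
        using norm_triangle_sub[of ?x "?P t"] by simp
      then have "(norm ?x)\<^sup>2 \<le> (2 * norm (?x - ?P t))\<^sup>2" by (rule power_mono) simp
      then have "B * (norm ?x)\<^sup>2 \<le> B * (4 * (norm (?x - ?P t))\<^sup>2)"
        using B by (simp add: power_mult_distrib)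
      with P show ?thesis by simp
    qed
    then show ?thesis by (intro eventually_mono[OF eventually_ge_at_top[of s]])
  qed
  then show thesis by (rule that)
qed

section \<open>Tangential and normal convergence\<close>

theorem corollary4p2:
  fixes f :: "real ^ 'n \<Rightarrow> real" and \<gamma> :: "real \<Rightarrow> real ^ 'n" and a :: ereal and p :: "real ^ 'n"
  assumes nonneg: "\<And>x. 0 \<le> f x"
    and Morse_Bott: "Morse_Bott f"
    and zeros_nonempty: "f -` {0} \<noteq> {}"
    and zeros_submanifold: "\<exists>k. submanifold k (f -` {0})"
    and flow: "gradient_flow_line f a \<infinity> \<gamma>"
    and lim: "(\<gamma> \<longlongrightarrow> p) at_top"
    and p: "p \<in> f -` {0}"
  defines "P \<equiv> orthogonal_projection (tangent_space (f -` {0}) p)"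
  defines "Q \<equiv> (\<lambda>x. x - P x)"
  shows "Limsup at_top (\<lambda>t. ereal (norm (P (\<gamma> t - p))) / ereal ((norm (Q (\<gamma> t - p)))\<^sup>2)) < \<infinity>"
proof -
  have smooth: "smooth_on f UNIV" using Morse_Bott unfolding Morse_Bott_def by blast
  obtain H C R where H: "linear H" "C \<ge> 0" "R > 0" "\<And>u v. u \<bullet> H v = hessian f p u v"
    "\<And>r x y. r \<le> R \<Longrightarrow> norm (x - p) \<le> r \<Longrightarrow> norm (y - p) \<le> r \<Longrightarrow>
        norm (gradient f x - gradient f y - H (x - y)) \<le> C * r * norm (x - y)"
    using smooth_gradient_expansion[OF smooth, of p] by blast
  interpret gradient_expansion f p H C R
    by (rule gradient_expansion.intro) (fact smooth H)+
  have fp: "f p = 0" using p by simp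
  then have "p \<in> critical_points f" using critical_iff gradient_at_zero[OF nonneg] by simp
  then obtain N where N: "nondegenerate_critical_manifold f N" "p \<in> N"
    using Morse_Bott unfolding Morse_Bott_def by blast
  obtain k where k: "submanifold k (f -` {0})" using zeros_submanifold by blast
  let ?T = "tangent_space (f -` {0}) p"
  obtain K \<rho> where est: "K > 0" "\<rho> > 0"
    "\<And>x. norm (x - p) < \<rho> \<Longrightarrow> f x \<le> K * (norm (gradient f x))\<^sup>2"
    "\<And>x v. norm (x - p) < \<rho> \<Longrightarrow> v \<in> ?T \<Longrightarrow>
        \<bar>v \<bullet> gradient f x\<bar> \<le> K * norm (x - p) * norm (gradient f x) * norm v"
    "\<And>x. norm (x - p) < \<rho> \<Longrightarrow> f x \<le> K * (norm (x - p))\<^sup>2"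
    by (rule gradient_estimates[OF nonneg fp k kernel_eq_tangent_space[OF nonneg fp N]]) blast
  obtain t0 where t0: "a < ereal t0"
    using flow unfolding gradient_flow_line_def by (metis ereal_dense2)
  have flow': "(\<gamma> has_vector_derivative - gradient f (\<gamma> t)) (at t)" if "t \<ge> t0" for t
  proof -
    have "a < ereal t" using t0 that by (metis ereal_less_eq(3) less_le_trans)
    then show ?thesis using flow unfolding gradient_flow_line_def einterval_def by simp
  qed
  obtain B where B: "\<forall>\<^sub>F t in at_top. norm (P (\<gamma> t - p)) \<le> B * (norm (Q (\<gamma> t - p)))\<^sup>2"
    unfolding P_def Q_def
    by (rule projection_eventually_quadratic[OF f_differentiable nonneg flow' lim
          subspace_tangent_space[OF k p] est])
  have "\<forall>\<^sub>F t in at_top.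
      ereal (norm (P (\<gamma> t - p))) / ereal ((norm (Q (\<gamma> t - p)))\<^sup>2) \<le> ereal \<bar>B\<bar>"
    using B
  proof (rule eventually_mono)
    fix t assume t: "norm (P (\<gamma> t - p)) \<le> B * (norm (Q (\<gamma> t - p)))\<^sup>2"
    show "ereal (norm (P (\<gamma> t - p))) / ereal ((norm (Q (\<gamma> t - p)))\<^sup>2) \<le> ereal \<bar>B\<bar>"
    \<comment> \<open>If the normal part vanishes, so does the tangential one, and the quotient is \<open>0 / 0 = 0\<close> in
      the extended reals rather than \<open>\<infinity>\<close>.\<close>
    proof (cases "Q (\<gamma> t - p) = 0")
      case True
      then have "norm (P (\<gamma> t - p)) = 0" using t by simp
      then show ?thesis by (simp add: zero_ereal_def[symmetric])
    next
      case False
      then have q: "(norm (Q (\<gamma> t - p)))\<^sup>2 > 0" by simp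
      have "norm (P (\<gamma> t - p)) / (norm (Q (\<gamma> t - p)))\<^sup>2 \<le> B"
        using t q by (simp add: divide_le_eq)
      then show ?thesis using False by simp
    qed
  qed
  then have "Limsup at_top (\<lambda>t. ereal (norm (P (\<gamma> t - p))) / ereal ((norm (Q (\<gamma> t - p)))\<^sup>2)) \<le> ereal \<bar>B\<bar>"
    by (rule Limsup_bounded)
  then show ?thesis by (rule le_less_trans) simp
qed

end
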